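(* Let $X$, $A$, $B$, $C$ be as in the context and let $W_1$ denote $D(A^{1/2})$ equipped with the norm $\|\xi\|_{A^{1/2}}:=\|A^{1/2}\xi\|$. Let $t_0\in\mathbb{R}$, $\xi\in D(A)$ and $\eta\in D(A^{1/2})$. Then there is a uniquely determined differentiable map $u:\mathbb{R}\to W_1$ with $u(t_0)=\xi$ and $u'(t_0)=\eta$ such that $u':\mathbb{R}\to X$ is differentiable with $(u')'(t)+iBu'(t)+(A+C)u(t)=0$ for all $t\in\mathbb{R}$.
   Context: $(X,\langle\cdot|\cdot\rangle)$ is a nontrivial complex Hilbert space with norm $\|\cdot\|$. $A:D(A)\to X$ is a densely defined self-adjoint linear operator with $\langle\xi|A\xi\rangle\geqslant\varepsilon\langle\xi|\xi\rangle$ for all $\xi\in D(A)$ for some $\varepsilon>0$; $A^{1/2}$ is its positive self-adjoint square root. $B:D(A^{1/2})\to X$ is linear with $\|B\xi\|^2\leqslant a^2\|A^{1/2}\xi\|^2+b^2\|\xi\|^2$ for all $\xi\in D(A^{1/2})$, for some $a\in[0,1)$, $b\in\mathbb{R}$, and $B$ is symmetric or bounded. $C:D(A^{1/2})\to X$ is linear with $\|C\xi\|^2\leqslant c^2\|A^{1/2}\xi\|^2+d^2\|\xi\|^2$ for all $\xi\in D(A^{1/2})$, for some real $c,d$. *)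

theory Defs
  imports "HOL-Analysis.Analysis"
begin

text \<open>A complex Hilbert space is modelled as a real Hilbert space
  (type class real_inner + complete_space) together with a complex structure J,
  which plays the role of multiplication by the imaginary unit i.\<close>

definition complex_structure :: "('a::real_inner \<Rightarrow> 'a) \<Rightarrow> bool" where
  "complex_structure J \<longleftrightarrow> linear J \<and> (\<forall>x. J (J x) = - x) \<and> (\<forall>x y. inner (J x) (J y) = inner x y)"

definition cscale :: "('a::real_vector \<Rightarrow> 'a) \<Rightarrow> complex \<Rightarrow> 'a \<Rightarrow> 'a" where
  "cscale J z x = Re z *\<^sub>R x + Im z *\<^sub>R J x"

text \<open>Complex inner product, conjugate-linear in the first and linear in the second argument.\<close>
definition cinner :: "('a::real_inner \<Rightarrow> 'a) \<Rightarrow> 'a \<Rightarrow> 'a \<Rightarrow> complex" where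
  "cinner J x y = Complex (inner x y) (- inner x (J y))"

definition csubspace :: "('a::real_vector \<Rightarrow> 'a) \<Rightarrow> 'a set \<Rightarrow> bool" where
  "csubspace J D \<longleftrightarrow> subspace D \<and> (\<forall>x\<in>D. J x \<in> D)"

definition clinear_on :: "('a::real_vector \<Rightarrow> 'a) \<Rightarrow> 'a set \<Rightarrow> ('a \<Rightarrow> 'a) \<Rightarrow> bool" where
  "clinear_on J D f \<longleftrightarrow> csubspace J D \<and>
     (\<forall>x\<in>D. \<forall>y\<in>D. \<forall>z w. f (cscale J z x + cscale J w y) = cscale J z (f x) + cscale J w (f y))"

text \<open>(D, T): a densely defined self-adjoint linear operator with domain D, i.e. T = T*.
  D(T*) = {y. \<exists>z. \<forall>x\<in>D. <Tx|y> = <x|z>}, and T* y = that z.\<close>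
definition self_adjoint_op :: "('a::real_inner \<Rightarrow> 'a) \<Rightarrow> 'a set \<Rightarrow> ('a \<Rightarrow> 'a) \<Rightarrow> bool" where
  "self_adjoint_op J D T \<longleftrightarrow> clinear_on J D T \<and> closure D = UNIV \<and>
     (\<forall>y. y \<in> D \<longleftrightarrow> (\<exists>z. \<forall>x\<in>D. cinner J (T x) y = cinner J x z)) \<and>
     (\<forall>x\<in>D. \<forall>y\<in>D. cinner J (T x) y = cinner J x (T y))"

definition is_sqrt_op :: "('a::real_inner \<Rightarrow> 'a) \<Rightarrow> 'a set \<Rightarrow> ('a \<Rightarrow> 'a) \<Rightarrow> 'a set \<Rightarrow> ('a \<Rightarrow> 'a) \<Rightarrow> bool" where
  "is_sqrt_op J DA A DS S \<longleftrightarrow> self_adjoint_op J DS S \<and>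
     (\<forall>x\<in>DS. Im (cinner J x (S x)) = 0 \<and> 0 \<le> Re (cinner J x (S x))) \<and>
     DA = {x\<in>DS. S x \<in> DS} \<and> (\<forall>x\<in>DA. S (S x) = A x)"

definition W1_has_derivative :: "'a set \<Rightarrow> ('a::real_normed_vector \<Rightarrow> 'a) \<Rightarrow> (real \<Rightarrow> 'a) \<Rightarrow> 'a \<Rightarrow> real \<Rightarrow> bool" where
  "W1_has_derivative DS S u v t \<longleftrightarrow> (\<forall>s. u s \<in> DS) \<and> v \<in> DS \<and>
     ((\<lambda>h. norm (S ((u (t + h) - u t) /\<^sub>R h - v))) \<longlongrightarrow> 0) (at 0)"

end

theory Submission
  imports Defs
begin

text \<open>
  Substituting \<open>p = S u\<close>, \<open>q = u'\<close>, where \<open>S\<close> is the square root of \<open>A\<close>, the equation becomes the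
  first order system \<open>p' = S q\<close>, \<open>q' = - S p - i B q - C S\<inverse> p\<close> on the Hilbert space \<open>X \<times> X\<close>, with domain
  \<open>D(S) \<times> D(S)\<close>. Its principal part is skew-adjoint, \<open>C S\<inverse>\<close> is bounded, and \<open>B\<close> has relative bound
  smaller than \<open>1\<close> with respect to \<open>S\<close>; hence a Neumann-type fixed point argument shows that
  \<open>l - G\<close> is onto for all real \<open>l\<close> of large modulus. As \<open>B\<close> is symmetric or bounded, the form
  \<open>\<langle>z, G z\<rangle>\<close> is bounded by a multiple of \<open>\<parallel>z\<parallel>\<^sup>2\<close>. This makes both \<open>G\<close> and \<open>- G\<close>
  quasi-m-dissipative, so that the flow exists forwards and backwards in time as the limit of the flows of
  the Yosida approximations, and it yields uniqueness by an energy estimate.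
\<close>

section \<open>Surjectivity of coercive self-adjoint operators\<close>

text \<open>The projection argument: a minimising sequence in \<open>M\<close> converges to a best
  approximation \<open>p\<close> of \<open>x\<close>, and \<open>x - p\<close> serves as
  \<open>g\<close>.\<close>

lemma closed_subspace_orthogonal:
  fixes M :: "'a::{real_inner, complete_space} set"
  assumes M: "subspace M" "closed M" and x: "x \<notin> M"
  shows "\<exists>g. g \<noteq> 0 \<and> (\<forall>y\<in>M. inner y g = 0)"
proof -
  define \<delta> where "\<delta> = (INF y\<in>M. (norm (x - y))\<^sup>2)"
  have M0: "0 \<in> M" using M(1) by (simp add: subspace_0)
  have bdd: "bdd_below ((\<lambda>y. (norm (x - y))\<^sup>2) ` M)" by (rule bdd_belowI[of _ 0]) auto
  have lower: "\<delta> \<le> (norm (x - y))\<^sup>2" if "y \<in> M" for y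
    unfolding \<delta>_def using that bdd by (intro cINF_lower)
  have "\<exists>y\<in>M. (norm (x - y))\<^sup>2 < \<delta> + 1 / real (Suc n)" for n
  proof -
    have "(INF y\<in>M. (norm (x - y))\<^sup>2) < \<delta> + 1 / real (Suc n)"
      by (simp add: \<delta>_def[symmetric] del: of_nat_Suc)
    then show ?thesis using M0 by (subst (asm) cINF_less_iff[OF _ bdd]) auto
  qed
  then obtain y where yM: "\<And>n. y n \<in> M"
    and y: "\<And>n. (norm (x - y n))\<^sup>2 < \<delta> + 1 / real (Suc n)" by metis
  \<comment> \<open>Parallelogram law for \<open>x - y m\<close> and \<open>x - y n\<close>: the
    midpoint of \<open>y m\<close> and \<open>y n\<close> lies in \<open>M\<close> and cannot beat
    the infimum \<delta>, so almost minimal points are close to each other.\<close>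
  have par: "(norm (y m - y n))\<^sup>2 \<le> 2 / real (Suc m) + 2 / real (Suc n)" for m n
  proof -
    have "(1/2) *\<^sub>R (y m + y n) \<in> M" using yM M(1) by (intro subspace_scale subspace_add) auto
    from lower[OF this] have "4 * \<delta> \<le> (norm (2 *\<^sub>R (x - (1/2) *\<^sub>R (y m + y n))))\<^sup>2"
      by (simp add: power_mult_distrib)
    also have "2 *\<^sub>R (x - (1/2) *\<^sub>R (y m + y n)) = (x - y m) + (x - y n)"
      by (simp add: algebra_simps scaleR_2)
    finally have "4 * \<delta> \<le> (norm ((x - y m) + (x - y n)))\<^sup>2" .
    moreover have "(norm (y m - y n))\<^sup>2 =
        2 * (norm (x - y m))\<^sup>2 + 2 * (norm (x - y n))\<^sup>2 - (norm ((x - y m) + (x - y n)))\<^sup>2"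
      unfolding power2_norm_eq_inner by (simp add: algebra_simps inner_commute)
    ultimately show ?thesis using y[of m] y[of n] by simp
  qed
  have "Cauchy y"
  proof (rule CauchyI)
    fix e :: real assume e: "0 < e"
    then obtain N :: nat where N: "4 / e\<^sup>2 < N" using reals_Archimedean2 by blast
    have "norm (y m - y n) < e" if "N \<le> m" "N \<le> n" for m n
    proof -
      have *: "2 / real (Suc k) < e\<^sup>2 / 2" if "N \<le> k" for k
      proof -
        have "4 < real N * e\<^sup>2" using N e by (simp add: field_simps)
        also have "\<dots> \<le> real (Suc k) * e\<^sup>2" using that by (intro mult_right_mono) auto
        finally show ?thesis by (simp add: field_simps)
      qed
      have "(norm (y m - y n))\<^sup>2 < e\<^sup>2" using par[of m n] *[of m] *[of n] that by linarith
      then show ?thesis using e by (simp add: power2_less_imp_less)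
    qed
    then show "\<exists>M. \<forall>m\<ge>M. \<forall>n\<ge>M. norm (y m - y n) < e" by blast
  qed
  then obtain p where p: "y \<longlonglongrightarrow> p" using Cauchy_convergent convergent_def by blast
  have pM: "p \<in> M" using closed_sequentially[OF M(2)] yM p by blast
  have "(\<lambda>n. (norm (x - y n))\<^sup>2) \<longlonglongrightarrow> (norm (x - p))\<^sup>2" by (intro tendsto_intros p)
  moreover have "(\<lambda>n. \<delta> + 1 / real (Suc n)) \<longlonglongrightarrow> \<delta> + 0"
    by (intro tendsto_intros LIMSEQ_Suc[OF lim_1_over_n])
  ultimately have le: "(norm (x - p))\<^sup>2 \<le> \<delta>"
    by (intro LIMSEQ_le[of _ _ _ "\<delta>"]) (use y less_imp_le in auto)
  have "inner v (x - p) = 0" if v: "v \<in> M" for v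
  proof (cases "v = 0")
    case False
    \<comment> \<open>This \<open>s\<close> minimises the distance along the line
      \<open>p + s *\<^sub>R v\<close>. As \<open>p\<close> is already optimal, the gain, the square
      of \<open>inner v (x - p)\<close> over \<open>inner v v\<close>, must vanish.\<close>
    define s where "s = inner v (x - p) / inner v v"
    have "p + s *\<^sub>R v \<in> M" using v pM M(1) by (intro subspace_add subspace_scale) auto
    from order_trans[OF le lower[OF this]]
    have "(norm (x - p))\<^sup>2 \<le> (norm ((x - p) - s *\<^sub>R v))\<^sup>2" by (simp only: diff_diff_eq)
    also have "\<dots> = (norm (x - p))\<^sup>2 - 2 * s * inner v (x - p) + s * (s * inner v v)"
      unfolding power2_norm_eq_inner by (simp add: algebra_simps inner_commute)
    also have "s * inner v v = inner v (x - p)" using False by (simp add: s_def)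
    finally have "s * inner v (x - p) \<le> 0" by simp
    then have "(inner v (x - p))\<^sup>2 / inner v v \<le> 0" by (simp add: s_def power2_eq_square)
    moreover have "inner v v > 0" using False by simp
    ultimately show ?thesis by (simp add: divide_le_0_iff)
  qed simp
  moreover have "x - p \<noteq> 0" using x pM by auto
  ultimately show ?thesis by blast
qed

text \<open>Only real linearity is recorded, since the generation theory below works with real inner
  products and real spectral parameters.\<close>

definition linear_op :: "'a::real_vector set \<Rightarrow> ('a \<Rightarrow> 'b::real_vector) \<Rightarrow> bool" where
  "linear_op D T \<longleftrightarrow> subspace D \<and> (\<forall>x\<in>D. \<forall>y\<in>D. T (x + y) = T x + T y) \<and>
     (\<forall>r. \<forall>x\<in>D. T (r *\<^sub>R x) = r *\<^sub>R T x)"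

lemma linear_opD:
  assumes "linear_op D T"
  shows "subspace D" "\<And>x y. x \<in> D \<Longrightarrow> y \<in> D \<Longrightarrow> T (x + y) = T x + T y"
    "\<And>r x. x \<in> D \<Longrightarrow> T (r *\<^sub>R x) = r *\<^sub>R T x"
    "\<And>x y. x \<in> D \<Longrightarrow> y \<in> D \<Longrightarrow> T (x - y) = T x - T y"
    "T 0 = 0"
proof -
  show *: "subspace D" "\<And>x y. x \<in> D \<Longrightarrow> y \<in> D \<Longrightarrow> T (x + y) = T x + T y"
    "\<And>r x. x \<in> D \<Longrightarrow> T (r *\<^sub>R x) = r *\<^sub>R T x" using assms unfolding linear_op_def by auto
  show "T (x - y) = T x - T y" if "x \<in> D" "y \<in> D" for x y
    using *(2)[of x "(-1) *\<^sub>R y"] *(3)[of y "-1"] subspace_neg[OF *(1)] that by simp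
  show "T 0 = 0" using *(3)[of 0 0] subspace_0[OF *(1)] by simp
qed

lemma eq_if_inner_eq_on_dense:
  fixes D :: "'a::real_inner set"
  assumes "closure D = UNIV" and "\<And>x. x \<in> D \<Longrightarrow> inner x y = inner x z"
  shows "y = z"
proof -
  have "closed {x. inner x y = inner x z}" by (intro closed_Collect_eq continuous_intros)
  moreover have "D \<subseteq> {x. inner x y = inner x z}" using assms(2) by auto
  ultimately have "closure D \<subseteq> {x. inner x y = inner x z}" by (rule closure_minimal[rotated])
  then have "inner (y - z) y = inner (y - z) z" using assms(1) by auto
  then have "inner (y - z) (y - z) = 0" by (simp add: inner_diff_right)
  then show ?thesis by simp
qed

text \<open>Coercivity bounds \<open>T\<close> from below, which together with self-adjointness
  makes the range closed. A vector orthogonal to the range is in the kernel of the adjoint, which is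
  \<open>T\<close> itself, hence zero by coercivity. The assumption \<open>maximal\<close> puts the
  domain of the adjoint inside \<open>D\<close>.\<close>

lemma coercive_self_adjoint_surj:
  fixes T :: "'a::{real_inner, complete_space} \<Rightarrow> 'a"
  assumes lin: "linear_op D T" and dense: "closure D = UNIV"
    and sym: "\<And>x y. x \<in> D \<Longrightarrow> y \<in> D \<Longrightarrow> inner (T x) y = inner x (T y)"
    and maximal: "\<And>y z. (\<And>x. x \<in> D \<Longrightarrow> inner (T x) y = inner x z) \<Longrightarrow> y \<in> D"
    and \<kappa>: "\<kappa> > 0" and coer: "\<And>x. x \<in> D \<Longrightarrow> \<kappa> * (norm x)\<^sup>2 \<le> inner x (T x)"
  shows "\<exists>x\<in>D. T x = f"
proof (rule ccontr)
  assume "\<not> ?thesis"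
  then have f: "f \<notin> T ` D" by auto
  note l = linear_opD[OF lin]
  have bound: "\<kappa> * norm x \<le> norm (T x)" if "x \<in> D" for x
  proof (cases "x = 0")
    case False
    have "(\<kappa> * norm x) * norm x \<le> norm (T x) * norm x"
      using coer[OF that] norm_cauchy_schwarz[of x "T x"]
      by (simp add: power2_eq_square mult.commute mult.left_commute)
    then show ?thesis using False by (simp only: mult_le_cancel_right) auto
  qed simp
  have sub: "subspace (T ` D)"
  proof (rule subspaceI)
    show "0 \<in> T ` D" using l(5) subspace_0[OF l(1)] by (metis imageI)
    show "x + y \<in> T ` D" if "x \<in> T ` D" "y \<in> T ` D" for x y
      using that l(2) subspace_add[OF l(1)] by (auto simp flip: l(2))
    show "r *\<^sub>R x \<in> T ` D" if "x \<in> T ` D" for r x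
      using that subspace_scale[OF l(1)] by (auto simp flip: l(3))
  qed
  have "closed (T ` D)"
    unfolding closed_sequential_limits
  proof (intro allI impI)
    fix g y assume gy: "(\<forall>n. g n \<in> T ` D) \<and> g \<longlonglongrightarrow> y"
    then have "\<forall>n. \<exists>x. x \<in> D \<and> g n = T x" by blast
    then obtain x where xD: "\<And>n. x n \<in> D" and gx: "\<And>n. g n = T (x n)" by metis
    have lim: "(\<lambda>n. T (x n)) \<longlonglongrightarrow> y" using gy by (simp flip: gx)
    have "Cauchy x"
    proof (rule CauchyI)
      fix e :: real assume "0 < e"
      then have "0 < \<kappa> * e" using \<kappa> by simp
      from CauchyD[OF LIMSEQ_imp_Cauchy[OF lim] this] obtain N
        where N: "\<forall>m\<ge>N. \<forall>n\<ge>N. norm (T (x m) - T (x n)) < \<kappa> * e" by blast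
      have "norm (x m - x n) < e" if "N \<le> m" "N \<le> n" for m n
      proof -
        have "\<kappa> * norm (x m - x n) < \<kappa> * e"
          using bound[of "x m - x n"] N that xD subspace_diff[OF l(1)] l(4)
          by (metis order.strict_trans1)
        then show ?thesis using \<kappa> by simp
      qed
      then show "\<exists>M. \<forall>m\<ge>M. \<forall>n\<ge>M. norm (x m - x n) < e" by blast
    qed
    then obtain p where p: "x \<longlonglongrightarrow> p" using Cauchy_convergent convergent_def by blast
    have weak: "inner (T v) p = inner v y" if "v \<in> D" for v
    proof (rule LIMSEQ_unique)
      show "(\<lambda>n. inner (T v) (x n)) \<longlonglongrightarrow> inner (T v) p" by (intro tendsto_intros p)
      show "(\<lambda>n. inner (T v) (x n)) \<longlonglongrightarrow> inner v y"
        unfolding sym[OF that xD] by (intro tendsto_intros lim)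
    qed
    have pD: "p \<in> D" using maximal weak by blast
    have "T p = y"
      using eq_if_inner_eq_on_dense[OF dense, of "T p" y] weak sym pD by simp
    then show "y \<in> T ` D" using pD by blast
  qed
  from closed_subspace_orthogonal[OF sub this f] obtain g
    where g: "g \<noteq> 0" "\<And>x. x \<in> D \<Longrightarrow> inner (T x) g = 0" by blast
  \<comment> \<open>Orthogonality to the range is the adjoint condition with
    \<open>z = 0\<close>.\<close>
  have gD: "g \<in> D" using maximal[of g 0] g(2) by simp
  have "\<kappa> * (norm g)\<^sup>2 \<le> 0" using coer[OF gD] g(2)[OF gD] by (simp add: inner_commute)
  moreover have "0 < \<kappa> * (norm g)\<^sup>2" using \<kappa> g(1) by simp
  ultimately show False by linarith
qed

section \<open>Linear evolution equations with a bounded generator\<close>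

text \<open>The differences \<open>f m - f n\<close> have small derivatives, hence a small Lipschitz
  constant uniformly in large \<open>m\<close> and \<open>n\<close>. Letting \<open>m\<close> tend
  to infinity transfers this to \<open>g - f n\<close>, and an \<open>e / 3\<close> argument with
  one fixed \<open>n\<close> finishes.\<close>

lemma has_vector_derivative_uniform_limit:
  fixes f :: "nat \<Rightarrow> real \<Rightarrow> 'a::real_normed_vector"
  assumes S: "convex S"
    and der: "\<And>n x. x \<in> S \<Longrightarrow> (f n has_vector_derivative f' n x) (at x within S)"
    and unif: "uniform_limit S f' g' sequentially"
    and lim: "\<And>x. x \<in> S \<Longrightarrow> (\<lambda>n. f n x) \<longlonglongrightarrow> g x"
    and x: "x \<in> S"
  shows "(g has_vector_derivative g' x) (at x within S)"
  unfolding has_vector_derivative_def has_derivative_within_alt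
proof (intro conjI allI impI)
  show "bounded_linear (\<lambda>r. r *\<^sub>R g' x)" by (rule bounded_linear_scaleR_left)
  fix e :: real assume e: "0 < e"
  have ev: "\<forall>\<^sub>F n in sequentially. \<forall>x\<in>S. \<forall>h. norm (h *\<^sub>R f' n x - h *\<^sub>R g' x) \<le> \<epsilon> * norm h"
    if "\<epsilon> > 0" for \<epsilon>
    using uniform_limitD[OF unif that]
  proof eventually_elim
    case (elim n)
    have "norm (h *\<^sub>R f' n y - h *\<^sub>R g' y) \<le> \<epsilon> * norm h" if "y \<in> S" for y h
      using mult_right_mono[of "norm (f' n y - g' y)" \<epsilon> "\<bar>h\<bar>"] elim that
      by (simp add: dist_norm mult.commute less_imp_le flip: scaleR_diff_right)
    then show ?case by blast
  qed
  have e3: "e / 3 > 0" using e by simp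
  obtain N where N: "\<And>m n y. N \<le> m \<Longrightarrow> N \<le> n \<Longrightarrow> y \<in> S \<Longrightarrow>
      norm ((f m y - f n y) - (f m x - f n x)) \<le> e / 3 * norm (y - x)"
    using has_derivative_sequence_Lipschitz[OF S der[unfolded has_vector_derivative_def] ev e3] x by blast
  obtain n where n: "N \<le> n" "norm (f' n x - g' x) \<le> e / 3"
    using eventually_happens[OF eventually_conj[OF eventually_ge_at_top[of N] uniform_limitD[OF unif e3]]] x
    by (auto simp: dist_norm less_imp_le)
  obtain d where d: "d > 0" "\<And>y. y \<in> S \<Longrightarrow> norm (y - x) < d \<Longrightarrow>
      norm (f n y - f n x - (y - x) *\<^sub>R f' n x) \<le> e / 3 * norm (y - x)"
    using der[OF x, of n] e3 unfolding has_vector_derivative_def has_derivative_within_alt by blast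
  have "norm (g y - g x - (y - x) *\<^sub>R g' x) \<le> e * norm (y - x)" if y: "y \<in> S" "norm (y - x) < d" for y
  proof -
    have 1: "norm ((g y - f n y) - (g x - f n x)) \<le> e / 3 * norm (y - x)"
    proof (rule Lim_bounded)
      show "(\<lambda>m. norm ((f m y - f n y) - (f m x - f n x))) \<longlonglongrightarrow> norm ((g y - f n y) - (g x - f n x))"
        by (intro tendsto_intros lim x y)
      show "\<forall>m\<ge>N. norm ((f m y - f n y) - (f m x - f n x)) \<le> e / 3 * norm (y - x)"
        using N n(1) y(1) by blast
    qed
    have 2: "norm ((y - x) *\<^sub>R (f' n x - g' x)) \<le> e / 3 * norm (y - x)"
      using mult_left_mono[OF n(2), of "\<bar>y - x\<bar>"] by (simp add: mult.commute)
    have "g y - g x - (y - x) *\<^sub>R g' x = ((g y - f n y) - (g x - f n x)) +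
        (f n y - f n x - (y - x) *\<^sub>R f' n x) + (y - x) *\<^sub>R (f' n x - g' x)"
      by (simp add: algebra_simps)
    also have "norm \<dots> \<le> e / 3 * norm (y - x) + e / 3 * norm (y - x) + e / 3 * norm (y - x)"
      by (intro norm_triangle_mono 1 2 d(2) y)
    finally show ?thesis by (simp add: algebra_simps)
  qed
  then show "\<exists>d>0. \<forall>y\<in>S. norm (y - x) < d \<longrightarrow> norm (g y - g x - (y - x) *\<^sub>R g' x) \<le> e * norm (y - x)"
    using d(1) by blast
qed

text \<open>The sort \<open>{real_inner, complete_space}\<close> is not a subsort of \<open>banach\<close>, so the
  library's Weierstrass test does not apply to it.\<close>
lemma uniformly_convergent_partial_sums:
  fixes f :: "nat \<Rightarrow> 'b \<Rightarrow> 'a::{real_normed_vector, complete_space}"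
  assumes bound: "\<And>n x. x \<in> A \<Longrightarrow> norm (f n x) \<le> M n" and M: "summable M"
  shows "uniformly_convergent_on A (\<lambda>n x. \<Sum>i<n. f i x)"
proof (intro Cauchy_uniformly_convergent uniformly_Cauchy_onI')
  fix e :: real assume "e > 0"
  then obtain N where N: "\<And>m n. m \<ge> N \<Longrightarrow> norm (sum M {m..<n}) < e"
    using M unfolding summable_Cauchy by blast
  have "dist (\<Sum>i<m. f i x) (\<Sum>i<n. f i x) < e" if "x \<in> A" "N \<le> m" "m < n" for x m n
  proof -
    have "dist (\<Sum>i<m. f i x) (\<Sum>i<n. f i x) = norm (\<Sum>i\<in>{m..<n}. f i x)"
      using that(3) sum_diff_nat_ivl[of 0 m n "\<lambda>i. f i x"]
      by (metis atLeast0LessThan dist_commute dist_norm le0 less_imp_le)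
    also have "\<dots> \<le> sum M {m..<n}" by (intro sum_norm_le bound that)
    also have "\<dots> < e" using N[OF that(2), of n] by simp
    finally show ?thesis .
  qed
  then show "\<exists>N. \<forall>x\<in>A. \<forall>m\<ge>N. \<forall>n>m. dist (\<Sum>i<m. f i x) (\<Sum>i<n. f i x) < e" by blast
qed

text \<open>The solution is the exponential series of \<open>t L\<close> applied to
  \<open>x\<close>. Its partial sums \<open>E n\<close> and their derivatives converge uniformly on
  bounded intervals.\<close>

lemma bounded_linear_ode_solution:
  fixes L :: "'a::{real_normed_vector, complete_space} \<Rightarrow> 'a"
  assumes L: "bounded_linear L"
  shows "\<exists>u. u 0 = x \<and> (\<forall>t. (u has_vector_derivative L (u t)) (at t))"
proof -
  define E where "E n t y = (\<Sum>k<n. (t ^ k / fact k) *\<^sub>R (L ^^ k) y)" for n t y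
  define u where "u t = lim (\<lambda>n. E n t x)" for t
  obtain K where K: "K \<ge> 0" "\<And>y. norm (L y) \<le> norm y * K"
    using bounded_linear.nonneg_bounded[OF L] by blast
  have pow: "norm ((L ^^ k) y) \<le> K ^ k * norm y" for k y
  proof (induction k)
    case (Suc k)
    have "norm ((L ^^ Suc k) y) \<le> norm ((L ^^ k) y) * K" using K(2) by simp
    also have "\<dots> \<le> K ^ k * norm y * K" using Suc K(1) by (rule mult_right_mono)
    finally show ?case by (simp add: algebra_simps)
  qed simp
  have unif: "uniformly_convergent_on {-r..r} (\<lambda>n t. E n t y)" for r y
    unfolding E_def
  proof (rule uniformly_convergent_partial_sums)
    show "summable (\<lambda>k. ((r * K) ^ k /\<^sub>R fact k) * norm y)"
      by (intro summable_mult2 summable_exp_generic)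
    fix n t assume t: "t \<in> {-r..r}"
    have "norm ((t ^ n / fact n) *\<^sub>R (L ^^ n) y) = \<bar>t\<bar> ^ n / fact n * norm ((L ^^ n) y)"
      by (simp add: power_abs)
    also have "\<dots> \<le> r ^ n / fact n * (K ^ n * norm y)"
      using t pow by (intro mult_mono divide_right_mono power_mono) auto
    finally show "norm ((t ^ n / fact n) *\<^sub>R (L ^^ n) y) \<le> ((r * K) ^ n /\<^sub>R fact n) * norm y"
      by (simp add: field_simps)
  qed
  have conv: "(\<lambda>n. E n t y) \<longlonglongrightarrow> lim (\<lambda>n. E n t y)" for t y
    by (rule tendsto_uniform_limitI[where S="{-\<bar>t\<bar>..\<bar>t\<bar>}"])
      (use unif[of "\<bar>t\<bar>" y] in \<open>auto simp: uniformly_convergent_uniform_limit_iff\<close>)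
  have E_L: "E n t (L y) = L (E n t y)" for n t y
    unfolding E_def by (simp add: linear_sum[OF bounded_linear.linear[OF L]]
        linear_scale[OF bounded_linear.linear[OF L]] funpow_swap1)
  \<comment> \<open>Differentiation lowers each power of \<open>t\<close> by one and leaves one more
    \<open>L\<close>, so the derivatives are again partial sums, one term shorter and taken at
    \<open>L y\<close>.\<close>
  have derE: "((\<lambda>t. E (Suc n) t y) has_vector_derivative E n t (L y)) (at t within S)" for n t y S
  proof (induction n)
    case 0
    show ?case by (simp add: E_def)
  next
    case (Suc n)
    have "((\<lambda>t. t ^ Suc n / fact (Suc n)) has_real_derivative (t ^ n / fact n)) (at t within S)"
      using DERIV_cdivide[OF DERIV_pow[of "Suc n" t S], of "fact (Suc n)"]
      by (simp add: fact_Suc del: of_nat_Suc power_Suc)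
    then have "((\<lambda>t. (t ^ Suc n / fact (Suc n)) *\<^sub>R (L ^^ Suc n) y)
        has_vector_derivative (t ^ n / fact n) *\<^sub>R (L ^^ Suc n) y) (at t within S)"
      using has_vector_derivative_scaleR[OF _ has_vector_derivative_const[of "(L ^^ Suc n) y"]]
      by (simp del: funpow.simps)
    from has_vector_derivative_add[OF Suc.IH this] show ?case
      unfolding E_def sum.lessThan_Suc by (simp add: funpow_swap1)
  qed
  have "(u has_vector_derivative L (u t)) (at t)" for t
  proof -
    \<comment> \<open>The extra 1 puts \<open>t\<close> in the interior of the interval, so that the
      derivative within it is a full one.\<close>
    define r where "r = \<bar>t\<bar> + 1"
    have t: "t \<in> {-r<..<r}" "t \<in> {-r..r}" unfolding r_def by auto
    have ul: "uniform_limit {-r..r} (\<lambda>n t. E n t (L x)) (\<lambda>t. lim (\<lambda>n. E n t (L x))) sequentially"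
      using unif[of r "L x"] unfolding uniformly_convergent_uniform_limit_iff .
    have "(u has_vector_derivative lim (\<lambda>n. E n t (L x))) (at t within {-r..r})"
      by (rule has_vector_derivative_uniform_limit[OF _ derE ul _ t(2)])
        (use LIMSEQ_Suc[OF conv] in \<open>auto simp: u_def\<close>)
    then have "(u has_vector_derivative lim (\<lambda>n. E n t (L x))) (at t)"
      using t(1) has_vector_derivative_within_open[OF t(1)]
      by (meson has_vector_derivative_within_subset greaterThanLessThan_subseteq_atLeastAtMost_iff
          open_greaterThanLessThan order_refl)
    moreover have "(\<lambda>n. L (E n t x)) \<longlonglongrightarrow> L (u t)"
      unfolding u_def by (intro bounded_linear.tendsto[OF L] conv)
    then have "lim (\<lambda>n. E n t (L x)) = L (u t)" unfolding E_L by (rule limI)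
    ultimately show ?thesis by simp
  qed
  moreover have "u 0 = x"
  proof -
    \<comment> \<open>\<open>E 0\<close> is the empty sum, so the value \<open>x\<close> is attained
      only from index 1 on.\<close>
    have "E (Suc n) 0 x = x" for n by (induction n) (auto simp: E_def)
    then have "(\<lambda>n. E (Suc n) 0 x) \<longlonglongrightarrow> x" by simp
    then show ?thesis unfolding u_def by (rule limI[OF LIMSEQ_imp_Suc])
  qed
  ultimately show ?thesis by blast
qed

lemma has_real_derivative_norm_square:
  fixes u :: "real \<Rightarrow> 'a::real_inner"
  assumes "(u has_vector_derivative u') (at t within S)"
  shows "((\<lambda>t. (norm (u t))\<^sup>2) has_real_derivative 2 * inner (u t) u') (at t within S)"
proof -
  have "((\<lambda>t. inner (u t) (u t)) has_derivative
      (\<lambda>h. inner (u t) (h *\<^sub>R u') + inner (h *\<^sub>R u') (u t))) (at t within S)"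
    using assms unfolding has_vector_derivative_def
    by (intro has_derivative_inner)
  then show ?thesis unfolding has_field_derivative_def power2_norm_eq_inner
    by (rule has_derivative_eq_rhs) (auto simp: inner_commute fun_eq_iff)
qed

text \<open>The squared norm has derivative \<open>2 * inner (u t) (u' t)\<close>, which is
  nonpositive.\<close>

lemma dissipative_flow_norm_le:
  fixes u :: "real \<Rightarrow> 'a::real_inner"
  assumes "\<And>t. t \<ge> 0 \<Longrightarrow> (u has_vector_derivative u' t) (at t)"
    and "\<And>t. t \<ge> 0 \<Longrightarrow> inner (u t) (u' t) \<le> 0" and t: "t \<ge> 0"
  shows "norm (u t) \<le> norm (u 0)"
proof -
  have "(norm (u t))\<^sup>2 \<le> (norm (u 0))\<^sup>2"
    using has_real_derivative_norm_square[OF assms(1)] assms(2)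
    by (intro DERIV_nonpos_imp_nonincreasing[OF t]) (metis mult_nonneg_nonpos zero_le_numeral)
  then show ?thesis by simp
qed

section \<open>Generation by m-dissipative operators\<close>

text \<open>The assumption \<open>range\<close> is the maximality condition, stated for all small
  steps \<open>h\<close> because the Yosida limit lets \<open>h\<close> tend to zero.\<close>

locale m_dissipative =
  fixes D :: "'a::{real_inner, complete_space} set" and T :: "'a \<Rightarrow> 'a" and h0 :: real
  assumes lin: "linear_op D T"
    and dense: "closure D = UNIV"
    and dissipative: "\<And>x. x \<in> D \<Longrightarrow> inner x (T x) \<le> 0"
    and h0: "h0 > 0"
    and range: "\<And>h f. 0 < h \<Longrightarrow> h \<le> h0 \<Longrightarrow> \<exists>x\<in>D. x - h *\<^sub>R T x = f"
begin

section \<open>Resolvents and Yosida approximations\<close>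

lemmas lin_simps = linear_opD[OF lin]
lemmas D_closed = subspace_add[OF lin_simps(1)] subspace_diff[OF lin_simps(1)]
  subspace_scale[OF lin_simps(1)]

text \<open>The inverse of \<open>1 - h T\<close>; that the choice is unique is shown in
  \<open>resolvent_eqI\<close>.\<close>

definition resolvent :: "real \<Rightarrow> 'a \<Rightarrow> 'a" where
  "resolvent h f = (SOME x. x \<in> D \<and> x - h *\<^sub>R T x = f)"

definition yosida :: "real \<Rightarrow> 'a \<Rightarrow> 'a" where
  "yosida h f = T (resolvent h f)"

lemma resolvent:
  assumes "0 < h" "h \<le> h0"
  shows "resolvent h f \<in> D" "resolvent h f - h *\<^sub>R T (resolvent h f) = f"
  using someI_ex[of "\<lambda>x. x \<in> D \<and> x - h *\<^sub>R T x = f"] range[OF assms, of f]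
  unfolding resolvent_def by auto

lemma resolvent_eq_add_yosida:
  assumes "0 < h" "h \<le> h0"
  shows "resolvent h f = f + h *\<^sub>R yosida h f"
  using resolvent(2)[OF assms, of f] unfolding yosida_def by (simp add: algebra_simps)

lemma yosida_eq:
  assumes "0 < h" "h \<le> h0"
  shows "yosida h f = (1 / h) *\<^sub>R (resolvent h f - f)"
proof -
  have "resolvent h f - f = h *\<^sub>R yosida h f" using resolvent_eq_add_yosida[OF assms, of f] by simp
  then show ?thesis using assms(1) by simp
qed

text \<open>Expanding the square, the cross term has the right sign by dissipativity. This gives
  both injectivity of \<open>1 - h T\<close> and contractivity of its inverse.\<close>

lemma norm_le_norm_diff_scale:
  assumes "x \<in> D" "0 < h"
  shows "norm x \<le> norm (x - h *\<^sub>R T x)"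
proof -
  have "(norm (x - h *\<^sub>R T x))\<^sup>2 = (norm x)\<^sup>2 - 2 * h * inner x (T x) + (norm (h *\<^sub>R T x))\<^sup>2"
    unfolding power2_norm_eq_inner by (simp add: algebra_simps inner_commute)
  moreover have "2 * h * inner x (T x) \<le> 0"
    using dissipative[OF assms(1)] assms(2) by (simp add: mult_nonneg_nonpos)
  moreover have "0 \<le> (norm (h *\<^sub>R T x))\<^sup>2" by simp
  ultimately have "(norm x)\<^sup>2 \<le> (norm (x - h *\<^sub>R T x))\<^sup>2" by linarith
  then show ?thesis by simp
qed

lemma resolvent_eqI:
  assumes h: "0 < h" "h \<le> h0" and x: "x \<in> D" "x - h *\<^sub>R T x = f"
  shows "resolvent h f = x"
proof -
  note r = resolvent[OF h, of f]
  have "norm (resolvent h f - x) \<le> norm (resolvent h f - x - h *\<^sub>R T (resolvent h f - x))"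
    using r(1) x(1) h(1) by (intro norm_le_norm_diff_scale D_closed)
  also have "\<dots> = norm ((resolvent h f - h *\<^sub>R T (resolvent h f)) - (x - h *\<^sub>R T x))"
    using r(1) x(1) by (simp add: lin_simps algebra_simps)
  also have "\<dots> = 0" unfolding r(2) x(2) by simp
  finally show ?thesis by simp
qed

lemma norm_resolvent_le:
  assumes h: "0 < h" "h \<le> h0"
  shows "norm (resolvent h f) \<le> norm f"
  using norm_le_norm_diff_scale[OF resolvent(1)[OF h] h(1), of f] resolvent(2)[OF h] by simp

lemma bounded_linear_resolvent:
  assumes h: "0 < h" "h \<le> h0"
  shows "bounded_linear (resolvent h)"
proof (rule bounded_linear_intro[where K=1])
  note r = resolvent[OF h]
  show "resolvent h (x + y) = resolvent h x + resolvent h y" for x y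
  proof (rule resolvent_eqI[OF h])
    have "resolvent h x + resolvent h y - h *\<^sub>R T (resolvent h x + resolvent h y) =
        (resolvent h x - h *\<^sub>R T (resolvent h x)) + (resolvent h y - h *\<^sub>R T (resolvent h y))"
      using r(1) by (simp add: lin_simps algebra_simps)
    then show "resolvent h x + resolvent h y - h *\<^sub>R T (resolvent h x + resolvent h y) = x + y"
      by (simp only: r(2))
  qed (intro D_closed r)
  show "resolvent h (c *\<^sub>R x) = c *\<^sub>R resolvent h x" for c x
  proof (rule resolvent_eqI[OF h])
    have "c *\<^sub>R resolvent h x - h *\<^sub>R T (c *\<^sub>R resolvent h x) =
        c *\<^sub>R (resolvent h x - h *\<^sub>R T (resolvent h x))"
      using r(1) by (simp add: lin_simps algebra_simps)
    then show "c *\<^sub>R resolvent h x - h *\<^sub>R T (c *\<^sub>R resolvent h x) = c *\<^sub>R x"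
      by (simp only: r(2))
  qed (intro D_closed r)
  show "norm (resolvent h x) \<le> norm x * 1" for x using norm_resolvent_le[OF h] by simp
qed

lemma bounded_linear_yosida:
  assumes h: "0 < h" "h \<le> h0"
  shows "bounded_linear (yosida h)"
proof -
  have "yosida h = (\<lambda>f. (1 / h) *\<^sub>R (resolvent h f - f))" by (rule ext) (rule yosida_eq[OF h])
  then show ?thesis
    using bounded_linear_const_scaleR[OF bounded_linear_sub[OF bounded_linear_resolvent[OF h] bounded_linear_ident]]
    by simp
qed

text \<open>Writing \<open>f\<close> as \<open>resolvent h f - h *\<^sub>R yosida h f\<close> leaves
  a dissipative term of \<open>T\<close> minus a multiple of a square.\<close>

lemma yosida_dissipative:
  assumes h: "0 < h" "h \<le> h0"
  shows "inner f (yosida h f) \<le> 0"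
proof -
  have "inner f (yosida h f) = inner (resolvent h f) (T (resolvent h f)) - h * inner (yosida h f) (yosida h f)"
    unfolding yosida_def by (subst (1) resolvent(2)[OF h, of f, symmetric]) (simp add: inner_diff_left)
  also have "\<dots> \<le> 0"
    using dissipative[OF resolvent(1)[OF h], of f] mult_nonneg_nonneg[OF less_imp_le[OF h(1)] inner_ge_zero[of "yosida h f"]]
    by linarith
  finally show ?thesis .
qed

text \<open>\<open>T\<close> commutes with its resolvent on \<open>D\<close>: for \<open>x\<close>
  in \<open>D\<close> the vector \<open>T ?r\<close> is a multiple of \<open>?r - x\<close>, hence
  in \<open>D\<close>, and \<open>T\<close> may be applied to the resolvent equation.\<close>

lemma yosida_eq_resolvent:
  assumes h: "0 < h" "h \<le> h0" and x: "x \<in> D"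
  shows "yosida h x = resolvent h (T x)"
proof -
  let ?r = "resolvent h x"
  note r = resolvent[OF h, of x]
  have "T ?r = (1 / h) *\<^sub>R (?r - x)"
    using yosida_eq[OF h, of x] unfolding yosida_def .
  then have TrD: "T ?r \<in> D" using r(1) x by (simp add: D_closed)
  have "T (?r - h *\<^sub>R T ?r) = T ?r - h *\<^sub>R T (T ?r)"
    using r(1) TrD by (simp add: lin_simps D_closed)
  then have "resolvent h (T x) = T ?r" using TrD r(2) by (intro resolvent_eqI[OF h]) auto
  then show ?thesis by (simp add: yosida_def)
qed

lemma norm_yosida_le:
  assumes h: "0 < h" "h \<le> h0" and x: "x \<in> D"
  shows "norm (yosida h x) \<le> norm (T x)"
  unfolding yosida_eq_resolvent[OF h x] by (rule norm_resolvent_le[OF h])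

text \<open>\<open>x n\<close> is the resolvent of \<open>x n - h0 *\<^sub>R T (x n)\<close>, and
  the resolvent is continuous.\<close>

lemma operator_closed:
  assumes x: "\<And>n. x n \<in> D" "x \<longlonglongrightarrow> y" "(\<lambda>n. T (x n)) \<longlonglongrightarrow> z"
  shows "y \<in> D \<and> T y = z"
proof -
  note h = h0 order_refl[of h0]
  have "(\<lambda>n. resolvent h0 (x n - h0 *\<^sub>R T (x n))) \<longlonglongrightarrow> resolvent h0 (y - h0 *\<^sub>R z)"
    by (intro bounded_linear.tendsto[OF bounded_linear_resolvent[OF h]] tendsto_intros x)
  moreover have "resolvent h0 (x n - h0 *\<^sub>R T (x n)) = x n" for n
    by (rule resolvent_eqI[OF h x(1) refl])
  ultimately have "y = resolvent h0 (y - h0 *\<^sub>R z)" using x(2) LIMSEQ_unique by auto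
  then show ?thesis using resolvent[OF h, of "y - h0 *\<^sub>R z"] h0 by simp
qed

section \<open>The flows of the Yosida approximations, that is, the exponentials of
  \<open>t * yosida h\<close>\<close>

definition flow :: "real \<Rightarrow> 'a \<Rightarrow> real \<Rightarrow> 'a" where
  "flow h x = (SOME u. u 0 = x \<and> (\<forall>t. (u has_vector_derivative yosida h (u t)) (at t)))"

lemma flow:
  assumes h: "0 < h" "h \<le> h0"
  shows "flow h x 0 = x" "(flow h x has_vector_derivative yosida h (flow h x t)) (at t)"
  using someI_ex[OF bounded_linear_ode_solution[OF bounded_linear_yosida[OF h], of x]]
  unfolding flow_def by auto

text \<open>A difference of solutions is a solution of the same dissipative equation. With equal
  initial values this is uniqueness.\<close>

lemma yosida_solution_diff_le:
  assumes h: "0 < h" "h \<le> h0" and t: "t \<ge> 0"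
    and u: "\<And>t. (u has_vector_derivative yosida h (u t)) (at t)"
    and v: "\<And>t. (v has_vector_derivative yosida h (v t)) (at t)"
  shows "norm (u t - v t) \<le> norm (u 0 - v 0)"
proof (rule dissipative_flow_norm_le[OF _ _ t])
  show "((\<lambda>t. u t - v t) has_vector_derivative yosida h (u t - v t)) (at t)" for t
    using has_vector_derivative_diff[OF u v]
    by (simp add: linear_diff[OF bounded_linear.linear[OF bounded_linear_yosida[OF h]]])
  show "inner (u t - v t) (yosida h (u t - v t)) \<le> 0" for t by (rule yosida_dissipative[OF h])
qed

lemma flow_diff_le:
  assumes h: "0 < h" "h \<le> h0" and t: "t \<ge> 0"
  shows "norm (flow h x t - flow h y t) \<le> norm (x - y)"
  using yosida_solution_diff_le[OF h t flow(2)[OF h] flow(2)[OF h], of x y] by (simp add: flow(1)[OF h])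

text \<open>Both sides solve the same equation with the same initial value.\<close>

lemma yosida_flow:
  assumes h: "0 < h" "h \<le> h0" and t: "t \<ge> 0"
  shows "yosida h (flow h x t) = flow h (yosida h x) t"
proof -
  have "((\<lambda>t. yosida h (flow h x t)) has_vector_derivative yosida h (yosida h (flow h x t))) (at t)" for t
    by (rule bounded_linear.has_vector_derivative[OF bounded_linear_yosida[OF h] flow(2)[OF h]])
  from yosida_solution_diff_le[OF h t this flow(2)[OF h, of "yosida h x"]]
  show ?thesis by (simp add: flow(1)[OF h])
qed

text \<open>The bound is uniform in the step and in time: the Yosida operator is moved onto the
  initial value, and the flow is a contraction fixing 0.\<close>

lemma norm_yosida_flow_le:
  assumes h: "0 < h" "h \<le> h0" and t: "t \<ge> 0" and x: "x \<in> D"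
  shows "norm (yosida h (flow h x t)) \<le> norm (T x)"
proof -
  have "flow h 0 t = 0"
  proof -
    have "((\<lambda>t. 0) has_vector_derivative yosida h 0) (at t)" for t
      by (simp add: linear_0[OF bounded_linear.linear[OF bounded_linear_yosida[OF h]]])
    from yosida_solution_diff_le[OF h t flow(2)[OF h, of 0] this] show ?thesis by (simp add: flow(1)[OF h])
  qed
  then have "norm (flow h (yosida h x) t) \<le> norm (yosida h x)"
    using flow_diff_le[OF h t, of "yosida h x" 0] by simp
  then show ?thesis using norm_yosida_le[OF h x] yosida_flow[OF h t] by simp
qed

text \<open>Splitting \<open>u = resolvent h u - h *\<^sub>R yosida h u\<close> in the first argument of the inner product
  leaves only a term of order \<open>h + k\<close>, the rest being dissipative.\<close>
lemma flow_dist_le: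
  assumes h: "0 < h" "h \<le> h0" and k: "0 < k" "k \<le> h0" and t: "t \<ge> 0" and x: "x \<in> D"
  shows "(norm (flow h x t - flow k x t))\<^sup>2 \<le> 4 * (h + k) * (norm (T x))\<^sup>2 * t"
proof -
  define M where "M = norm (T x)"
  let ?w = "\<lambda>t. flow h x t - flow k x t"
  let ?p = "\<lambda>t. yosida h (flow h x t)" and ?q = "\<lambda>t. yosida k (flow k x t)"
  \<comment> \<open>The slope subtracted is twice the bound of \<open>est\<close>, so that the
    derivative becomes nonpositive.\<close>
  let ?\<phi> = "\<lambda>t. (norm (?w t))\<^sup>2 - 4 * (h + k) * M\<^sup>2 * t"
  have est: "inner (?w s) (?p s - ?q s) \<le> 2 * (h + k) * M\<^sup>2" if s: "s \<ge> 0" for s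
  proof -
    let ?a = "resolvent h (flow h x s)" and ?b = "resolvent k (flow k x s)"
    have ab: "?a \<in> D" "?b \<in> D" using resolvent h k by auto
    have p: "norm (?p s) \<le> M" "norm (?q s) \<le> M"
      unfolding M_def using norm_yosida_flow_le h k s x by auto
    have M0: "0 \<le> M" by (simp add: M_def)
    have "?w s = (?a - ?b) + (k *\<^sub>R ?q s - h *\<^sub>R ?p s)"
      by (simp add: resolvent_eq_add_yosida[OF h] resolvent_eq_add_yosida[OF k])
    moreover have "?p s - ?q s = T (?a - ?b)" using ab by (simp add: yosida_def lin_simps)
    ultimately have "inner (?w s) (?p s - ?q s) =
        inner (?a - ?b) (T (?a - ?b)) + inner (k *\<^sub>R ?q s - h *\<^sub>R ?p s) (?p s - ?q s)"
      by (simp only: inner_add_left)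
    also have "\<dots> \<le> 0 + norm (k *\<^sub>R ?q s - h *\<^sub>R ?p s) * norm (?p s - ?q s)"
      using ab by (intro add_mono dissipative D_closed norm_cauchy_schwarz)
    also have "\<dots> \<le> 0 + (k * M + h * M) * (M + M)"
      using h k p M0 mult_left_mono[OF p(1), of h] mult_left_mono[OF p(2), of k]
      by (intro add_mono mult_mono order_refl order_trans[OF norm_triangle_ineq4]) auto
    finally show ?thesis by (simp add: algebra_simps power2_eq_square)
  qed
  have "?\<phi> t \<le> ?\<phi> 0"
  proof (rule DERIV_nonpos_imp_nonincreasing[OF t])
    fix s :: real assume "0 \<le> s"
    have "(?w has_vector_derivative ?p s - ?q s) (at s)"
      by (intro has_vector_derivative_diff flow h k)
    then have "(?\<phi> has_real_derivative 2 * inner (?w s) (?p s - ?q s) - 4 * (h + k) * M\<^sup>2) (at s)"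
      by (intro DERIV_diff has_real_derivative_norm_square) (auto intro!: derivative_eq_intros)
    moreover have "2 * inner (?w s) (?p s - ?q s) - 4 * (h + k) * M\<^sup>2 \<le> 0"
      using est[OF \<open>0 \<le> s\<close>] unfolding mult.assoc by linarith
    ultimately show "\<exists>y. (?\<phi> has_real_derivative y) (at s) \<and> y \<le> 0" by blast
  qed
  then show ?thesis by (simp add: M_def flow(1)[OF h] flow(1)[OF k])
qed

section \<open>Passage to the limit of vanishing step size\<close>

definition step :: "nat \<Rightarrow> real" where
  "step n = h0 / real (Suc n)"

lemma step: "0 < step n" "step n \<le> h0"
  using h0 by (auto simp: step_def field_simps)

lemma step_tendsto: "step \<longlonglongrightarrow> 0"
  unfolding step_def using tendsto_mult_right_zero[OF LIMSEQ_Suc[OF lim_1_over_n], of h0] by simp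

lemma domain_approximates:
  assumes "e > 0"
  obtains y where "y \<in> D" "norm (x - y) < e"
proof -
  have "x \<in> closure D" using dense by simp
  then obtain y where "y \<in> D" "dist y x < e" using closure_approachable assms by blast
  then show ?thesis using that by (simp add: dist_norm norm_minus_commute)
qed

text \<open>For initial values in \<open>D\<close> the Cauchy property is
  \<open>flow_dist_le\<close>; density and contractivity extend it to all \<open>x\<close>, with
  errors \<open>e / 4\<close>, \<open>e / 2\<close>, \<open>e / 4\<close>.\<close>

lemma flow_uniformly_convergent:
  "uniformly_convergent_on {0..\<tau>} (\<lambda>n t. flow (step n) x t)"
proof (intro Cauchy_uniformly_convergent uniformly_Cauchy_onI)
  fix e :: real assume e: "e > 0"
  obtain y where y: "y \<in> D" "norm (x - y) < e / 4"
    using domain_approximates[of "e / 4"] e by auto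
  define C where "C = (norm (T y))\<^sup>2 * \<bar>\<tau>\<bar>"
  have "(\<lambda>n. 4 * step n * C) \<longlonglongrightarrow> 4 * 0 * C" by (intro tendsto_intros step_tendsto)
  then have "\<forall>\<^sub>F n in sequentially. 4 * step n * C < e\<^sup>2 / 8"
    using e by (intro order_tendstoD(2)[where y="4 * 0 * C"]) auto
  then obtain N where N: "\<And>n. n \<ge> N \<Longrightarrow> 4 * step n * C < e\<^sup>2 / 8"
    unfolding eventually_sequentially by blast
  have "dist (flow (step m) x t) (flow (step n) x t) < e" if t: "t \<in> {0..\<tau>}" and mn: "N \<le> m" "N \<le> n" for t m n
  proof -
    have t0: "t \<ge> 0" using t by simp
    have "(norm (flow (step m) y t - flow (step n) y t))\<^sup>2 \<le> 4 * (step m + step n) * ((norm (T y))\<^sup>2 * t)"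
      using flow_dist_le[OF step step t0 y(1)] by (simp add: mult.assoc)
    also have "\<dots> \<le> 4 * (step m + step n) * C"
    proof (rule mult_left_mono)
      show "(norm (T y))\<^sup>2 * t \<le> C" unfolding C_def using t by (intro mult_left_mono) auto
      show "0 \<le> 4 * (step m + step n)" using step(1) by (intro mult_nonneg_nonneg add_nonneg_nonneg) (auto intro: less_imp_le)
    qed
    also have "\<dots> = 4 * step m * C + 4 * step n * C" by (simp add: algebra_simps)
    also have "\<dots> < (e / 2)\<^sup>2"
    proof -
      have "(e / 2)\<^sup>2 = e\<^sup>2 / 4" by (simp add: power_divide)
      then show ?thesis using N[OF mn(1)] N[OF mn(2)] by linarith
    qed
    finally have 1: "norm (flow (step m) y t - flow (step n) y t) < e / 2"
      by (rule power2_less_imp_less) (use e in simp)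
    have "norm (flow (step k) x t - flow (step k) y t) \<le> norm (x - y)" for k
      by (rule flow_diff_le[OF step t0])
    from this[of m] this[of n] show ?thesis using 1 y(2)
        dist_triangle[of "flow (step m) x t" "flow (step n) x t" "flow (step m) y t"]
        dist_triangle2[of "flow (step m) y t" "flow (step n) x t" "flow (step n) y t"]
      unfolding dist_norm by linarith
  qed
  then show "\<exists>N. \<forall>t\<in>{0..\<tau>}. \<forall>m\<ge>N. \<forall>n\<ge>N. dist (flow (step m) x t) (flow (step n) x t) < e" by blast
qed

definition semigroup :: "'a \<Rightarrow> real \<Rightarrow> 'a" where
  "semigroup x t = lim (\<lambda>n. flow (step n) x t)"

lemma flow_uniform_limit:
  "uniform_limit {0..\<tau>} (\<lambda>n t. flow (step n) x t) (semigroup x) sequentially"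
  using flow_uniformly_convergent[where x=x and \<tau>=\<tau>] unfolding uniformly_convergent_uniform_limit_iff semigroup_def .

lemma flow_tendsto:
  assumes "t \<ge> 0"
  shows "(\<lambda>n. flow (step n) x t) \<longlonglongrightarrow> semigroup x t"
  using tendsto_uniform_limitI[OF flow_uniform_limit[where x=x and \<tau>=t], of t] assms by simp

text \<open>On \<open>D\<close> the error is \<open>step n\<close> times a bounded Yosida term;
  contractivity and density give the rest.\<close>

lemma resolvent_tendsto: "(\<lambda>n. resolvent (step n) x) \<longlonglongrightarrow> x"
proof (rule LIMSEQ_I)
  fix e :: real assume e: "e > 0"
  obtain y where y: "y \<in> D" "norm (x - y) < e / 3"
    using domain_approximates[of "e / 3"] e by auto
  have "(\<lambda>n. step n * norm (T y)) \<longlonglongrightarrow> 0" by (intro tendsto_mult_left_zero step_tendsto)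
  then have "\<forall>\<^sub>F n in sequentially. step n * norm (T y) < e / 3"
    using e by (intro order_tendstoD(2)[where y=0]) auto
  then obtain N where N: "\<And>n. n \<ge> N \<Longrightarrow> step n * norm (T y) < e / 3"
    unfolding eventually_sequentially by blast
  have "norm (resolvent (step n) x - x) < e" if "n \<ge> N" for n
  proof -
    have "norm (resolvent (step n) x - resolvent (step n) y) \<le> norm (x - y)"
      using norm_resolvent_le[OF step, of n "x - y"]
      by (simp add: linear_diff[OF bounded_linear.linear[OF bounded_linear_resolvent[OF step]]])
    moreover have "norm (resolvent (step n) y - y) \<le> step n * norm (T y)"
      using norm_yosida_le[OF step y(1), of n] step(1)[of n]
      by (simp add: resolvent_eq_add_yosida[OF step])
    ultimately show ?thesis
      using N[OF that] y(2)
        dist_triangle[of "resolvent (step n) x" x "resolvent (step n) y"]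
        dist_triangle2[of "resolvent (step n) y" x y]
      unfolding dist_norm by linarith
  qed
  then show "\<exists>N. \<forall>n\<ge>N. norm (resolvent (step n) x - x) < e" by blast
qed

lemma yosida_tendsto:
  assumes "x \<in> D"
  shows "(\<lambda>n. yosida (step n) x) \<longlonglongrightarrow> T x"
  using resolvent_tendsto[of "T x"] by (simp add: yosida_eq_resolvent[OF step assms])

text \<open>These are the time derivatives of the flows. Moving the Yosida operator onto the initial
  value turns them into flows started near \<open>T x\<close>.\<close>

lemma yosida_flow_uniform_limit:
  assumes x: "x \<in> D"
  shows "uniform_limit {0..\<tau>} (\<lambda>n t. yosida (step n) (flow (step n) x t)) (semigroup (T x)) sequentially"
proof (rule uniform_limitI)
  fix e :: real assume "e > 0"
  then have e: "e / 2 > 0" by simp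
  show "\<forall>\<^sub>F n in sequentially. \<forall>t\<in>{0..\<tau>}. dist (yosida (step n) (flow (step n) x t)) (semigroup (T x) t) < e"
    using uniform_limitD[OF flow_uniform_limit[where x="T x" and \<tau>=\<tau>] e] tendstoD[OF yosida_tendsto[OF x] e]
  proof eventually_elim
    case (elim n)
    show ?case
    proof
      fix t assume t: "t \<in> {0..\<tau>}"
      then have "dist (flow (step n) (yosida (step n) x) t) (flow (step n) (T x) t) < e / 2"
        using flow_diff_le[OF step, of t n "yosida (step n) x" "T x"] elim(2) by (simp add: dist_norm)
      moreover have "dist (flow (step n) (T x) t) (semigroup (T x) t) < e / 2" using elim(1) t by blast
      ultimately have "dist (flow (step n) (yosida (step n) x) t) (semigroup (T x) t) < e"
        using dist_triangle[of "flow (step n) (yosida (step n) x) t" "semigroup (T x) t" "flow (step n) (T x) t"]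
        by linarith
      then show "dist (yosida (step n) (flow (step n) x t)) (semigroup (T x) t) < e"
        using t by (simp add: yosida_flow[OF step])
    qed
  qed
qed

text \<open>Closedness of \<open>T\<close> is applied to the resolvents of the flows: they lie in
  \<open>D\<close>, their images under \<open>T\<close> are the Yosida terms, and they differ from
  the flows by a vanishing amount.\<close>

lemma semigroup_in_domain:
  assumes x: "x \<in> D" and t: "t \<ge> 0"
  shows "semigroup x t \<in> D \<and> T (semigroup x t) = semigroup (T x) t"
proof (rule operator_closed)
  let ?r = "\<lambda>n. resolvent (step n) (flow (step n) x t)"
  have lim: "(\<lambda>n. yosida (step n) (flow (step n) x t)) \<longlonglongrightarrow> semigroup (T x) t"
    using tendsto_uniform_limitI[OF yosida_flow_uniform_limit[OF x, of t], of t] t by simp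
  show "?r n \<in> D" for n by (rule resolvent[OF step])
  show "(\<lambda>n. T (?r n)) \<longlonglongrightarrow> semigroup (T x) t" using lim by (simp add: yosida_def)
  have "(\<lambda>n. flow (step n) x t + step n *\<^sub>R yosida (step n) (flow (step n) x t))
      \<longlonglongrightarrow> semigroup x t + 0 *\<^sub>R semigroup (T x) t"
    by (intro tendsto_intros flow_tendsto[OF t] step_tendsto lim)
  then show "?r \<longlonglongrightarrow> semigroup x t" by (simp add: resolvent_eq_add_yosida[OF step])
qed

lemma semigroup_has_vector_derivative:
  assumes x: "x \<in> D" and t: "t \<ge> 0"
  shows "(semigroup x has_vector_derivative T (semigroup x t)) (at t within {0..})"
proof -
  \<comment> \<open>The right end \<open>t + 1\<close> keeps \<open>t\<close> away from the end of
    the interval, so the half-line has the same filter at \<open>t\<close>.\<close>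
  have "(semigroup x has_vector_derivative semigroup (T x) t) (at t within {0..t + 1})"
  proof (rule has_vector_derivative_uniform_limit[OF _ _ yosida_flow_uniform_limit[OF x]])
    show "(flow (step n) x has_vector_derivative yosida (step n) (flow (step n) x s)) (at s within {0..t + 1})" for n s
      by (rule has_vector_derivative_at_within[OF flow(2)[OF step]])
  qed (use flow_tendsto t in auto)
  moreover have "at t within {0..t + 1} = at t within {0..}"
    by (rule at_within_nhd[of _ "{..<t + 1}"]) auto
  ultimately show ?thesis using semigroup_in_domain[OF x t] by simp
qed

lemma semigroup_zero: "semigroup x 0 = x"
  unfolding semigroup_def by (simp add: flow(1)[OF step])

end

section \<open>Quasi-dissipative operators: forward flow, two-sided flow, range and
  uniqueness\<close>

text \<open>The shift \<open>T - \<omega>\<close> is dissipative and its semigroup is rescaled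
  by \<open>exp (\<omega> * t)\<close>.\<close>
lemma quasi_dissipative_forward_solution:
  fixes T :: "'a::{real_inner, complete_space} \<Rightarrow> 'a"
  assumes lin: "linear_op D T" and dense: "closure D = UNIV"
    and quasi: "\<And>x. x \<in> D \<Longrightarrow> inner x (T x) \<le> \<omega> * (norm x)\<^sup>2"
    and range: "\<And>l f. l \<ge> l0 \<Longrightarrow> \<exists>x\<in>D. l *\<^sub>R x - T x = f"
    and x: "x \<in> D"
  shows "\<exists>u. u 0 = x \<and> (\<forall>t\<ge>0. u t \<in> D \<and> (u has_vector_derivative T (u t)) (at t within {0..}))"
proof -
  note l = linear_opD[OF lin]
  \<comment> \<open>Then \<open>1 / h \<ge> \<bar>l0\<bar> + \<bar>\<omega>\<bar> + 1\<close> for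
    every admissible \<open>h\<close>, so \<open>1 / h + \<omega>\<close> lies in the given range
    condition.\<close>
  define h0 where "h0 = 1 / (\<bar>l0\<bar> + \<bar>\<omega>\<bar> + 1)"
  have h0: "h0 > 0" by (simp add: h0_def add_nonneg_pos)
  interpret m_dissipative D "\<lambda>x. T x - \<omega> *\<^sub>R x" h0
  proof
    show "linear_op D (\<lambda>x. T x - \<omega> *\<^sub>R x)"
      using l unfolding linear_op_def by (auto simp: algebra_simps)
    show "inner x (T x - \<omega> *\<^sub>R x) \<le> 0" if "x \<in> D" for x
      using quasi[OF that] by (simp add: inner_diff_right power2_norm_eq_inner)
    fix h f assume h: "0 < h" "h \<le> h0"
    have "1 / h \<ge> 1 / h0" using h by (simp add: frac_le)
    then have "1 / h + \<omega> \<ge> l0" by (simp add: h0_def)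
    from range[OF this, of "(1 / h) *\<^sub>R f"] obtain y
      where y: "y \<in> D" "(1 / h + \<omega>) *\<^sub>R y - T y = (1 / h) *\<^sub>R f" by blast
    from arg_cong[OF y(2), of "\<lambda>v. h *\<^sub>R v"] have "y - h *\<^sub>R (T y - \<omega> *\<^sub>R y) = f"
      using h by (simp add: algebra_simps)
    then show "\<exists>x\<in>D. x - h *\<^sub>R (T x - \<omega> *\<^sub>R x) = f" using y(1) by blast
  qed (use dense h0 in auto)
  let ?u = "\<lambda>t. exp (\<omega> * t) *\<^sub>R semigroup x t"
  have "?u t \<in> D \<and> (?u has_vector_derivative T (?u t)) (at t within {0..})" if t: "t \<ge> 0" for t
  proof
    have sD: "semigroup x t \<in> D" using semigroup_in_domain[OF x t] by blast
    then show "?u t \<in> D" by (rule D_closed)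
    have "((\<lambda>t. exp (\<omega> * t)) has_real_derivative \<omega> * exp (\<omega> * t)) (at t within {0..})"
      by (auto intro!: derivative_eq_intros)
    from has_vector_derivative_scaleR[OF this semigroup_has_vector_derivative[OF x t]]
    show "(?u has_vector_derivative T (?u t)) (at t within {0..})"
      using sD by (simp add: l algebra_simps)
  qed
  then show ?thesis by (intro exI[of _ ?u]) (auto simp: semigroup_zero)
qed

text \<open>The forward solution for \<open>- T\<close>, run backwards in time, supplies the
  negative times; the two halves are glued at 0 and translated to \<open>t0\<close>.\<close>

lemma group_solution:
  fixes T :: "'a::{real_inner, complete_space} \<Rightarrow> 'a"
  assumes lin: "linear_op D T" and dense: "closure D = UNIV"
    and quasi: "\<And>x. x \<in> D \<Longrightarrow> \<bar>inner x (T x)\<bar> \<le> \<omega> * (norm x)\<^sup>2"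
    and range: "\<And>l f. \<bar>l\<bar> \<ge> l0 \<Longrightarrow> \<exists>x\<in>D. l *\<^sub>R x - T x = f"
    and x: "x \<in> D"
  shows "\<exists>u. u t0 = x \<and> (\<forall>t. u t \<in> D \<and> (u has_vector_derivative T (u t)) (at t))"
proof -
  note l = linear_opD[OF lin]
  have "\<exists>u. u 0 = x \<and> (\<forall>t\<ge>0. u t \<in> D \<and> (u has_vector_derivative T (u t)) (at t within {0..}))"
    by (rule quasi_dissipative_forward_solution[OF lin dense _ _ x, of \<omega> "l0"])
      (use quasi range abs_le_iff in \<open>fastforce+\<close>)
  then obtain u where u: "u 0 = x" "\<And>t. t \<ge> 0 \<Longrightarrow> u t \<in> D"
    "\<And>t. t \<ge> 0 \<Longrightarrow> (u has_vector_derivative T (u t)) (at t within {0..})" by blast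
  have "\<exists>v. v 0 = x \<and> (\<forall>t\<ge>0. v t \<in> D \<and> (v has_vector_derivative - T (v t)) (at t within {0..}))"
  proof (rule quasi_dissipative_forward_solution[OF _ dense _ _ x, of "\<lambda>x. - T x" \<omega> l0])
    show "linear_op D (\<lambda>x. - T x)" using l unfolding linear_op_def by auto
    show "inner y (- T y) \<le> \<omega> * (norm y)\<^sup>2" if "y \<in> D" for y
      using quasi[OF that] by (simp add: abs_le_iff)
    show "\<exists>y\<in>D. r *\<^sub>R y - - T y = f" if r: "l0 \<le> r" for r f
    proof -
      \<comment> \<open>The range condition constrains only the modulus of the parameter, so
        \<open>- r\<close> is admissible.\<close>
      obtain y where y: "y \<in> D" "(- r) *\<^sub>R y - T y = - f" using range[of "-r" "-f"] r by fastforce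
      from arg_cong[OF y(2), of uminus] y(1) show ?thesis by (intro bexI[of _ y]) (auto simp: algebra_simps)
    qed
  qed
  then obtain v where v: "v 0 = x" "\<And>t. t \<ge> 0 \<Longrightarrow> v t \<in> D"
    "\<And>t. t \<ge> 0 \<Longrightarrow> (v has_vector_derivative - T (v t)) (at t within {0..})" by blast
  define w where "w t = (if t \<in> {0..} then u t else v (- t))" for t
  have vneg: "((\<lambda>t. v (- t)) has_vector_derivative T (v (- t))) (at t within {..0})" if "t \<le> 0" for t
  proof -
    have img: "uminus ` {..0::real} = {0..}" by (auto simp: image_iff intro: bexI[of _ "- _"])
    have "(uminus has_vector_derivative - 1) (at t within {..0})"
      by (auto intro!: derivative_eq_intros)
    from vector_diff_chain_within[OF this, of v "- T (v (- t))"] v(3)[of "- t"] that show ?thesis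
      unfolding img by (simp add: o_def)
  qed
  have wD: "w t \<in> D" for t using u v by (simp add: w_def)
  have wder: "(w has_vector_derivative T (w t)) (at t)" for t
  proof -
    \<comment> \<open>The half-lines meet only at 0, where both values are \<open>x\<close> and both
      one-sided derivatives are \<open>T x\<close>.\<close>
    have "((\<lambda>t. if t \<in> {0..} then u t else v (- t)) has_vector_derivative
        (if t \<in> {0..} then T (u t) else T (v (- t)))) (at t within UNIV)"
      by (rule has_vector_derivative_If_within_closures[where T="{..0}"])
        (use u(1,3) v(1) vneg in \<open>auto simp: insert_absorb\<close>)
    then show ?thesis unfolding w_def by (simp split: if_splits)
  qed
  have "((\<lambda>t. w (t - t0)) has_vector_derivative T (w (t - t0))) (at t)" for t
    using vector_diff_chain_at[of "\<lambda>t. t - t0" 1 t w "T (w (t - t0))"] wder[of "t - t0"]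
    by (simp add: o_def has_vector_derivative_diff_const)
  moreover have "w 0 = x" using u(1) by (simp add: w_def)
  ultimately show ?thesis using wD by (intro exI[of _ "\<lambda>t. w (t - t0)"]) simp
qed

text \<open>With \<open>R\<close> the inverse of \<open>l - G\<close>, the map
  \<open>y \<mapsto> f + Q (R y)\<close> contracts with factor
  \<open>a + \<beta> / \<bar>l\<bar>\<close>. Its fixed point \<open>y\<close> yields the solution
  \<open>R y\<close>.\<close>

lemma perturbed_range:
  fixes G Q :: "'a::{real_normed_vector, complete_space} \<Rightarrow> 'a"
  assumes G: "linear_op D G" and Q: "linear_op D Q" and l: "l \<noteq> 0"
    and surj: "\<And>f. \<exists>x\<in>D. l *\<^sub>R x - G x = f"
    and norm_le: "\<And>x. x \<in> D \<Longrightarrow> \<bar>l\<bar> * norm x \<le> norm (l *\<^sub>R x - G x)"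
    and norm_G_le: "\<And>x. x \<in> D \<Longrightarrow> norm (G x) \<le> norm (l *\<^sub>R x - G x)"
    and Q_le: "\<And>x. x \<in> D \<Longrightarrow> norm (Q x) \<le> a * norm (G x) + \<beta> * norm x"
    and a: "0 \<le> a" "0 \<le> \<beta>" and small: "a + \<beta> / \<bar>l\<bar> < 1"
  shows "\<exists>x\<in>D. l *\<^sub>R x - (G x + Q x) = f"
proof -
  note lG = linear_opD[OF G] and lQ = linear_opD[OF Q]
  obtain R where R: "\<And>y. R y \<in> D" "\<And>y. l *\<^sub>R R y - G (R y) = y" using surj by metis
  have "dist (f + Q (R y)) (f + Q (R y')) \<le> (a + \<beta> / \<bar>l\<bar>) * dist y y'" for y y'
  proof -
    let ?x = "R y - R y'"
    have xD: "?x \<in> D" using R(1) by (intro subspace_diff[OF lG(1)])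
    have "l *\<^sub>R ?x - G ?x = (l *\<^sub>R R y - G (R y)) - (l *\<^sub>R R y' - G (R y'))"
      using R(1) by (simp add: lG algebra_simps)
    then have eq: "l *\<^sub>R ?x - G ?x = y - y'" by (simp only: R(2))
    have 1: "norm ?x \<le> norm (y - y') / \<bar>l\<bar>"
      using norm_le[OF xD] l unfolding eq by (simp add: field_simps)
    have "dist (f + Q (R y)) (f + Q (R y')) = norm (Q ?x)"
      using R(1) by (simp add: lQ dist_norm)
    also have "\<dots> \<le> a * norm (G ?x) + \<beta> * norm ?x" by (rule Q_le[OF xD])
    also have "\<dots> \<le> a * norm (y - y') + \<beta> * (norm (y - y') / \<bar>l\<bar>)"
      using norm_G_le[OF xD] 1 a unfolding eq by (intro add_mono mult_left_mono) auto
    finally show ?thesis by (simp add: dist_norm algebra_simps)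
  qed
  then obtain y where y: "f + Q (R y) = y"
    using banach_fix_type[of "a + \<beta> / \<bar>l\<bar>" "\<lambda>y. f + Q (R y)"] small a by auto
  have "l *\<^sub>R R y - (G (R y) + Q (R y)) = y - Q (R y)" using R(2)[of y] by (simp add: algebra_simps)
  also have "\<dots> = f" using y by (simp add: algebra_simps)
  finally show ?thesis using R(1) by blast
qed

text \<open>A Gronwall argument for the difference \<open>w\<close>: its squared norm, weighted by
  an exponential, is monotone and vanishes at \<open>t0\<close>.\<close>

lemma group_solution_unique:
  fixes T :: "'a::real_inner \<Rightarrow> 'a"
  assumes lin: "linear_op D T"
    and quasi: "\<And>x. x \<in> D \<Longrightarrow> \<bar>inner x (T x)\<bar> \<le> \<omega> * (norm x)\<^sup>2"
    and u: "\<And>t. u t \<in> D" "\<And>t. (u has_vector_derivative T (u t)) (at t)"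
    and v: "\<And>t. v t \<in> D" "\<And>t. (v has_vector_derivative T (v t)) (at t)"
    and init: "u t0 = v t0"
  shows "u t = v t"
proof -
  note l = linear_opD[OF lin]
  define w where "w t = u t - v t" for t
  have wD: "w t \<in> D" for t unfolding w_def by (intro subspace_diff[OF l(1)] u v)
  have w: "(w has_vector_derivative T (w t)) (at t)" for t
    using has_vector_derivative_diff[OF u(2) v(2), of t] u(1) v(1) unfolding w_def by (simp add: l)
  have der: "((\<lambda>t. (norm (w t))\<^sup>2 * exp (\<kappa> * t)) has_real_derivative
      (2 * inner (w t) (T (w t)) + \<kappa> * (norm (w t))\<^sup>2) * exp (\<kappa> * t)) (at t)" for t \<kappa>
    by (rule derivative_eq_intros has_real_derivative_norm_square w refl | simp add: algebra_simps)+
  have w0: "w t0 = 0" using init by (simp add: w_def)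
  have q: "\<bar>inner (w s) (T (w s))\<bar> \<le> \<omega> * (norm (w s))\<^sup>2" for s using quasi wD by blast
  \<comment> \<open>The sign of \<kappa> makes the weighted square nonincreasing after
    \<open>t0\<close> and nondecreasing before it.\<close>
  have "(norm (w t))\<^sup>2 * exp (\<kappa> * t) \<le> 0" if \<kappa>: "\<kappa> = (if t0 \<le> t then - 2 * \<omega> else 2 * \<omega>)" for \<kappa>
  proof (cases "t0 \<le> t")
    case True
    have "(2 * inner (w s) (T (w s)) + \<kappa> * (norm (w s))\<^sup>2) * exp (\<kappa> * s) \<le> 0" for s
      using q[of s] True \<kappa> by (intro mult_nonpos_nonneg) (auto simp: abs_le_iff)
    then have "(norm (w t))\<^sup>2 * exp (\<kappa> * t) \<le> (norm (w t0))\<^sup>2 * exp (\<kappa> * t0)"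
      using der by (intro DERIV_nonpos_imp_nonincreasing[OF True]) blast
    then show ?thesis by (simp add: w0)
  next
    case False
    then have le: "t \<le> t0" by simp
    have "(2 * inner (w s) (T (w s)) + \<kappa> * (norm (w s))\<^sup>2) * exp (\<kappa> * s) \<ge> 0" for s
      using q[of s] False \<kappa> by (intro mult_nonneg_nonneg) (auto simp: abs_le_iff)
    then have "(norm (w t))\<^sup>2 * exp (\<kappa> * t) \<le> (norm (w t0))\<^sup>2 * exp (\<kappa> * t0)"
      using der by (intro DERIV_nonneg_imp_nondecreasing[OF le]) (rule exI, rule conjI)
    then show ?thesis by (simp add: w0)
  qed
  from this[OF refl] have "w t = 0" by (simp add: mult_le_0_iff)
  then show ?thesis by (simp add: w_def)
qed

section \<open>The damped wave equation\<close>

lemma complex_structureD: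
  assumes "complex_structure J"
  shows "inner (J x) y = - inner x (J y)" "norm (J x) = norm x" "J (x + y) = J x + J y"
    "J (r *\<^sub>R x) = r *\<^sub>R J x"
proof -
  have J: "linear J" "\<And>x. J (J x) = - x" "\<And>x y. inner (J x) (J y) = inner x y"
    using assms unfolding complex_structure_def by auto
  show "inner (J x) y = - inner x (J y)" using J(3)[of x "J y"] by (simp add: J(2))
  show "norm (J x) = norm x" by (simp add: norm_eq_sqrt_inner J(3))
  show "J (x + y) = J x + J y" "J (r *\<^sub>R x) = r *\<^sub>R J x"
    using J(1) by (auto simp: linear_add linear_scale)
qed

lemma clinear_onD:
  assumes "clinear_on J D f"
  shows "linear_op D f" "x \<in> D \<Longrightarrow> J x \<in> D" "x \<in> D \<Longrightarrow> f (J x) = J (f x)"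
proof -
  have D: "subspace D" "\<And>x. x \<in> D \<Longrightarrow> J x \<in> D"
    and f: "\<And>x y z w. x \<in> D \<Longrightarrow> y \<in> D \<Longrightarrow>
      f (cscale J z x + cscale J w y) = cscale J z (f x) + cscale J w (f y)"
    using assms unfolding clinear_on_def csubspace_def by auto
  have "f (r *\<^sub>R x) = r *\<^sub>R f x" if "x \<in> D" for r x
    using f[OF that that, of "of_real r" 0] by (simp add: cscale_def)
  moreover have "f (x + y) = f x + f y" if "x \<in> D" "y \<in> D" for x y
    using f[OF that, of 1 1] by (simp add: cscale_def)
  ultimately show "linear_op D f" unfolding linear_op_def using D(1) by auto
  show "J x \<in> D" if "x \<in> D" using D(2) that .
  show "f (J x) = J (f x)" if "x \<in> D" using f[OF that that, of \<i> 0] by (simp add: cscale_def)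
qed

text \<open>Passes from complex to real self-adjointness, the form in which the preceding theory
  applies.\<close>

lemma self_adjoint_opD:
  assumes J: "complex_structure J" and T: "self_adjoint_op J D T"
  shows "linear_op D T" "closure D = UNIV"
    "\<And>x y. x \<in> D \<Longrightarrow> y \<in> D \<Longrightarrow> inner (T x) y = inner x (T y)"
    "\<And>y z. (\<And>x. x \<in> D \<Longrightarrow> inner (T x) y = inner x z) \<Longrightarrow> y \<in> D"
proof -
  have cl: "clinear_on J D T" using T by (simp add: self_adjoint_op_def)
  show "linear_op D T" by (rule clinear_onD[OF cl])
  show "closure D = UNIV" using T by (simp add: self_adjoint_op_def)
  show "inner (T x) y = inner x (T y)" if "x \<in> D" "y \<in> D" for x y
  proof -
    have "cinner J (T x) y = cinner J x (T y)" using T that unfolding self_adjoint_op_def by blast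
    then show ?thesis by (simp add: cinner_def)
  qed
  show "y \<in> D" if yz: "\<And>x. x \<in> D \<Longrightarrow> inner (T x) y = inner x z" for y z
  proof -
    \<comment> \<open>The real identity at \<open>x\<close> gives the real part, and at
      \<open>J x\<close> the imaginary part.\<close>
    have "cinner J (T x) y = cinner J x z" if x: "x \<in> D" for x
      using yz[OF x] yz[OF clinear_onD(2)[OF cl x]] clinear_onD(3)[OF cl x]
        complex_structureD(1)[OF J, of "T x" y] complex_structureD(1)[OF J, of x z]
      by (simp add: cinner_def)
    then show ?thesis using T unfolding self_adjoint_op_def by blast
  qed
qed

lemma le_of_square_le:
  fixes n p q :: real
  assumes "n\<^sup>2 \<le> \<alpha>\<^sup>2 * p\<^sup>2 + \<beta>\<^sup>2 * q\<^sup>2" "0 \<le> p" "0 \<le> q"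
  shows "n \<le> \<bar>\<alpha>\<bar> * p + \<bar>\<beta>\<bar> * q"
proof (rule power2_le_imp_le)
  have "0 \<le> (\<bar>\<alpha>\<bar> * p) * (\<bar>\<beta>\<bar> * q)" using assms by simp
  then show "n\<^sup>2 \<le> (\<bar>\<alpha>\<bar> * p + \<bar>\<beta>\<bar> * q)\<^sup>2"
    using assms(1) by (simp add: power2_sum power_mult_distrib)
  show "0 \<le> \<bar>\<alpha>\<bar> * p + \<bar>\<beta>\<bar> * q" using assms by simp
qed

locale damped_wave =
  fixes J :: "'a::{real_inner, complete_space} \<Rightarrow> 'a"
    and DA DS :: "'a set" and A S B C :: "'a \<Rightarrow> 'a" and \<epsilon> a b c d :: real
  assumes J: "complex_structure J"
    and A_sa: "self_adjoint_op J DA A"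
    and eps: "\<epsilon> > 0"
    and A_pos: "\<forall>x\<in>DA. Re (cinner J x (A x)) \<ge> \<epsilon> * Re (cinner J x x)"
    and S: "is_sqrt_op J DA A DS S"
    and B_lin: "clinear_on J DS B"
    and a: "0 \<le> a" "a < 1"
    and B_bound: "\<forall>x\<in>DS. (norm (B x))\<^sup>2 \<le> a\<^sup>2 * (norm (S x))\<^sup>2 + b\<^sup>2 * (norm x)\<^sup>2"
    and B_sym_or_bdd: "(\<forall>x\<in>DS. \<forall>y\<in>DS. cinner J (B x) y = cinner J x (B y))
                       \<or> (\<exists>K. \<forall>x\<in>DS. norm (B x) \<le> K * norm x)"
    and C_lin: "clinear_on J DS C"
    and C_bound: "\<forall>x\<in>DS. (norm (C x))\<^sup>2 \<le> c\<^sup>2 * (norm (S x))\<^sup>2 + d\<^sup>2 * (norm x)\<^sup>2"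
begin

section \<open>The square root \<open>S\<close> and its bounded inverse\<close>

lemmas A_real = self_adjoint_opD[OF J A_sa]

lemma S_sa: "self_adjoint_op J DS S"
  using S by (simp add: is_sqrt_op_def)

lemmas S_real = self_adjoint_opD[OF J S_sa]
lemmas S_lin = linear_opD[OF S_real(1)]

lemma in_DA_iff: "x \<in> DA \<longleftrightarrow> x \<in> DS \<and> S x \<in> DS"
  using S by (auto simp: is_sqrt_op_def)

lemma S_S: "x \<in> DA \<Longrightarrow> S (S x) = A x"
  using S by (auto simp: is_sqrt_op_def)

lemma A_coercive: "x \<in> DA \<Longrightarrow> \<epsilon> * (norm x)\<^sup>2 \<le> inner x (A x)"
  using A_pos by (auto simp: cinner_def power2_norm_eq_inner)

text \<open>A nonnegative shift preserves self-adjointness and the constant \<epsilon>. The case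
  \<open>\<mu> = 0\<close> inverts \<open>A\<close>; \<open>\<mu> = l\<^sup>2\<close> serves the
  free system.\<close>

lemma A_shift_surj:
  assumes "\<mu> \<ge> 0"
  shows "\<exists>x\<in>DA. A x + \<mu> *\<^sub>R x = f"
proof (rule coercive_self_adjoint_surj[OF _ A_real(2) _ _ eps, of "\<lambda>x. A x + \<mu> *\<^sub>R x"])
  show "linear_op DA (\<lambda>x. A x + \<mu> *\<^sub>R x)"
    using linear_opD[OF A_real(1)] unfolding linear_op_def by (auto simp: algebra_simps)
  show "inner (A x + \<mu> *\<^sub>R x) y = inner x (A y + \<mu> *\<^sub>R y)" if "x \<in> DA" "y \<in> DA" for x y
    using A_real(3)[OF that] by (simp add: inner_add_left inner_add_right)
  show "y \<in> DA" if "\<And>x. x \<in> DA \<Longrightarrow> inner (A x + \<mu> *\<^sub>R x) y = inner x z" for y z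
  proof (rule A_real(4))
    show "inner (A x) y = inner x (z - \<mu> *\<^sub>R y)" if "x \<in> DA" for x
      using \<open>\<And>x. x \<in> DA \<Longrightarrow> inner (A x + \<mu> *\<^sub>R x) y = inner x z\<close>[OF that]
      by (simp add: inner_add_left inner_diff_right)
  qed
  show "\<epsilon> * (norm x)\<^sup>2 \<le> inner x (A x + \<mu> *\<^sub>R x)" if "x \<in> DA" for x
    using A_coercive[OF that] assms by (simp add: inner_add_right add_increasing2)
qed

lemma S_surj: "\<exists>x\<in>DS. S x = f"
  using A_shift_surj[of 0 f] in_DA_iff S_S by force

text \<open>Coercivity of \<open>A\<close> lives on \<open>DA\<close> only, so a duality argument
  reaches all of \<open>DS\<close>: with \<open>A w = x\<close>, the square of \<open>norm x\<close>
  is \<open>inner (S x) (S w)\<close>, and \<open>sqrt \<epsilon> * norm (S w)\<close> is at most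
  \<open>norm x\<close>.\<close>

lemma S_coercive:
  assumes x: "x \<in> DS"
  shows "sqrt \<epsilon> * norm x \<le> norm (S x)"
proof (cases "x = 0")
  case False
  obtain w where w: "w \<in> DA" "A w = x" using A_shift_surj[of 0 x] by auto
  have wS: "w \<in> DS" "S w \<in> DS" using w(1) in_DA_iff by auto
  have Sw: "(norm (S w))\<^sup>2 = inner w x"
    using S_real(3)[OF wS] S_S[OF w(1)] w(2) by (simp add: power2_norm_eq_inner)
  have "\<epsilon> * (norm (S w))\<^sup>2 \<le> (norm x)\<^sup>2"
  proof -
    have *: "inner w x \<le> norm w * norm x" by (rule norm_cauchy_schwarz)
    have "\<epsilon> * (norm w)\<^sup>2 \<le> norm w * norm x" using A_coercive[OF w(1)] w(2) * by simp
    then have "norm w * (\<epsilon> * norm w) \<le> norm w * norm x" by (simp add: power2_eq_square algebra_simps)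
    then have "\<epsilon> * norm w \<le> norm x" by (cases "w = 0") (auto simp: mult_le_cancel_left)
    then have "\<epsilon> * norm w * norm x \<le> norm x * norm x" by (intro mult_right_mono) auto
    moreover have "\<epsilon> * (norm (S w))\<^sup>2 \<le> \<epsilon> * (norm w * norm x)" unfolding Sw using * eps by simp
    ultimately show ?thesis by (simp add: power2_eq_square mult.assoc)
  qed
  then have 1: "sqrt \<epsilon> * norm (S w) \<le> norm x"
    using real_sqrt_le_mono by (fastforce simp: real_sqrt_mult)
  have "(norm x)\<^sup>2 = inner (S x) (S w)"
    using S_real(3)[OF x wS(2)] S_S[OF w(1)] w(2) by (simp add: power2_norm_eq_inner)
  also have "\<dots> \<le> norm (S x) * norm (S w)" by (rule norm_cauchy_schwarz)
  finally have "sqrt \<epsilon> * (norm x)\<^sup>2 \<le> sqrt \<epsilon> * (norm (S x) * norm (S w))"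
    using eps by (intro mult_left_mono) auto
  also have "\<dots> = norm (S x) * (sqrt \<epsilon> * norm (S w))" by simp
  also have "\<dots> \<le> norm (S x) * norm x" using 1 by (intro mult_left_mono) auto
  finally have "(sqrt \<epsilon> * norm x) * norm x \<le> norm (S x) * norm x"
    by (simp add: power2_eq_square algebra_simps)
  then show ?thesis using False by (simp only: mult_le_cancel_right) auto
qed simp

definition S_inv :: "'a \<Rightarrow> 'a" where
  "S_inv f = (SOME x. x \<in> DS \<and> S x = f)"

lemma S_inv: "S_inv f \<in> DS" "S (S_inv f) = f"
  using someI_ex[of "\<lambda>x. x \<in> DS \<and> S x = f"] S_surj[of f] unfolding S_inv_def by auto

lemma S_inject:
  assumes "x \<in> DS" "y \<in> DS" "S x = S y"
  shows "x = y"
proof -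
  have "sqrt \<epsilon> * norm (x - y) \<le> norm (S (x - y))"
    using assms by (intro S_coercive subspace_diff[OF S_lin(1)])
  then have "sqrt \<epsilon> * norm (x - y) \<le> 0" using assms by (simp add: S_lin)
  then show ?thesis using eps by (simp add: mult_le_0_iff)
qed

lemma S_inv_S: "x \<in> DS \<Longrightarrow> S_inv (S x) = x"
  by (rule S_inject) (simp_all add: S_inv)

lemma S_inv_linear:
  "S_inv (x + y) = S_inv x + S_inv y" "S_inv (r *\<^sub>R x) = r *\<^sub>R S_inv x"
  by (rule S_inject; simp add: S_inv S_lin subspace_add[OF S_lin(1)] subspace_scale[OF S_lin(1)])+

lemmas B_real = linear_opD[OF clinear_onD(1)[OF B_lin]]
lemmas C_real = linear_opD[OF clinear_onD(1)[OF C_lin]]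

text \<open>A bound for the norm of \<open>C\<close> composed with the inverse of \<open>S\<close>,
  whose own norm is at most \<open>1 / sqrt \<epsilon>\<close>.\<close>

definition \<gamma> :: real where
  "\<gamma> = \<bar>c\<bar> + \<bar>d\<bar> / sqrt \<epsilon>"

lemma \<gamma>_nonneg: "\<gamma> \<ge> 0"
  using eps by (simp add: \<gamma>_def)

lemma norm_C_S_inv_le: "norm (C (S_inv p)) \<le> \<gamma> * norm p"
proof -
  have "norm (C (S_inv p)) \<le> \<bar>c\<bar> * norm (S (S_inv p)) + \<bar>d\<bar> * norm (S_inv p)"
    using C_bound S_inv(1) by (intro le_of_square_le) auto
  moreover have "norm (S_inv p) \<le> norm p / sqrt \<epsilon>"
    using S_coercive[OF S_inv(1), of p] eps by (simp add: S_inv(2) field_simps)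
  then have "\<bar>d\<bar> * norm (S_inv p) \<le> \<bar>d\<bar> * (norm p / sqrt \<epsilon>)" by (intro mult_left_mono) auto
  ultimately show ?thesis by (simp add: S_inv(2) \<gamma>_def algebra_simps)
qed

lemma norm_B_le: "x \<in> DS \<Longrightarrow> norm (B x) \<le> a * norm (S x) + \<bar>b\<bar> * norm x"
  using le_of_square_le[of "norm (B x)" a "norm (S x)" b "norm x"] B_bound a by simp

section \<open>The first order system on the phase space\<close>

text \<open>With \<open>p = S u\<close> and \<open>q = u'\<close> the equation reads \<open>(p, q)' = free (p, q) + damping (p, q)\<close>.\<close>

definition free :: "'a \<times> 'a \<Rightarrow> 'a \<times> 'a" where
  "free z = (S (snd z), - S (fst z))"

definition damping :: "'a \<times> 'a \<Rightarrow> 'a \<times> 'a" where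
  "damping z = (0, - J (B (snd z)) - C (S_inv (fst z)))"

lemma linear_op_free: "linear_op (DS \<times> DS) free"
  unfolding linear_op_def
  using subspace_Times[OF S_lin(1) S_lin(1)] by (auto simp: free_def S_lin)

lemma linear_op_damping: "linear_op (DS \<times> DS) damping"
  unfolding linear_op_def
  using subspace_Times[OF S_lin(1) S_lin(1)]
  by (auto simp: damping_def B_real C_real complex_structureD[OF J] S_inv_linear S_inv scaleR_diff_right)

lemma free_skew: "z \<in> DS \<times> DS \<Longrightarrow> inner z (free z) = 0"
  using S_real(3)[of "fst z" "snd z"] by (auto simp: free_def inner_prod_def inner_commute)

text \<open>Skewness removes the cross term. Dropping either summand gives one of the two norm
  bounds that \<open>perturbed_range\<close> asks for.\<close>

lemma norm_square_shift_free:
  assumes "z \<in> DS \<times> DS"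
  shows "(norm (l *\<^sub>R z - free z))\<^sup>2 = l\<^sup>2 * (norm z)\<^sup>2 + (norm (free z))\<^sup>2"
  using free_skew[OF assms]
  unfolding power2_norm_eq_inner
  by (simp add: inner_diff_left inner_diff_right inner_commute power2_eq_square)

text \<open>With \<open>R = (l\<^sup>2 + A)\<inverse>\<close> the solution is \<open>p = l R f + S R g\<close>, \<open>q = l R g - S R f\<close>.\<close>
lemma shift_free_surj:
  assumes l: "l \<noteq> 0"
  shows "\<exists>z\<in>DS \<times> DS. l *\<^sub>R z - free z = f"
proof -
  obtain x where x: "x \<in> DA" "A x + l\<^sup>2 *\<^sub>R x = fst f" using A_shift_surj[of "l\<^sup>2"] by auto
  obtain y where y: "y \<in> DA" "A y + l\<^sup>2 *\<^sub>R y = snd f" using A_shift_surj[of "l\<^sup>2"] by auto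
  have D: "x \<in> DS" "S x \<in> DS" "y \<in> DS" "S y \<in> DS" using x y in_DA_iff by auto
  let ?z = "(l *\<^sub>R x + S y, l *\<^sub>R y - S x)"
  have "?z \<in> DS \<times> DS"
    using D by (auto intro!: subspace_add[OF S_lin(1)] subspace_diff[OF S_lin(1)] subspace_scale[OF S_lin(1)])
  moreover have "l *\<^sub>R ?z - free ?z = (A x + l\<^sup>2 *\<^sub>R x, A y + l\<^sup>2 *\<^sub>R y)"
    using D x(1) y(1)
    by (simp add: free_def S_lin subspace_scale[OF S_lin(1)] S_S power2_eq_square algebra_simps)
  ultimately show ?thesis using x(2) y(2) by (intro bexI[of _ ?z]) auto
qed

text \<open>\<open>S (snd z)\<close> is a component of \<open>free z\<close>, so \<open>B\<close>
  costs only the factor \<open>a\<close>; everything bounded goes into the second summand.\<close>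

lemma norm_damping_le:
  assumes z: "z \<in> DS \<times> DS"
  shows "norm (damping z) \<le> a * norm (free z) + (\<bar>b\<bar> + \<gamma>) * norm z"
proof -
  have "norm (damping z) \<le> norm (B (snd z)) + norm (C (S_inv (fst z)))"
    using norm_triangle_ineq4[of "- J (B (snd z))" "C (S_inv (fst z))"]
    by (simp add: damping_def norm_Pair complex_structureD(2)[OF J])
  also have "\<dots> \<le> (a * norm (S (snd z)) + \<bar>b\<bar> * norm (snd z)) + \<gamma> * norm (fst z)"
    using z by (intro add_mono norm_B_le norm_C_S_inv_le) auto
  also have "\<dots> \<le> (a * norm (free z) + \<bar>b\<bar> * norm z) + \<gamma> * norm z"
    using a \<gamma>_nonneg norm_fst_le[of "S (snd z)" "- S (fst z)"] norm_fst_le[of "fst z" "snd z"]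
      norm_snd_le[of "snd z" "fst z"]
    by (intro add_mono mult_left_mono) (auto simp: free_def)
  finally show ?thesis by (simp add: algebra_simps)
qed

text \<open>For symmetric \<open>B\<close> the number \<open>cinner J q (B q)\<close> is real, so
  the real part of its product with the imaginary unit vanishes. For bounded \<open>B\<close>, and
  for the term with \<open>C\<close>, Cauchy-Schwarz suffices.\<close>

lemma damping_quasi_skew:
  "\<exists>\<omega>. \<forall>z\<in>DS \<times> DS. \<bar>inner z (damping z)\<bar> \<le> \<omega> * (norm z)\<^sup>2"
proof -
  have "\<exists>K\<ge>0. \<forall>q\<in>DS. \<bar>inner q (J (B q))\<bar> \<le> K * (norm q)\<^sup>2"
    using B_sym_or_bdd
  proof
    assume sym: "\<forall>x\<in>DS. \<forall>y\<in>DS. cinner J (B x) y = cinner J x (B y)"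
    have "inner q (J (B q)) = 0" if "q \<in> DS" for q
      using sym[rule_format, OF that that] complex_structureD(1)[OF J, of q "B q"]
      by (simp add: cinner_def inner_commute)
    then show ?thesis by (intro exI[of _ 0]) auto
  next
    assume "\<exists>K. \<forall>x\<in>DS. norm (B x) \<le> K * norm x"
    then obtain K where K: "\<And>x. x \<in> DS \<Longrightarrow> norm (B x) \<le> K * norm x" by blast
    have "\<bar>inner q (J (B q))\<bar> \<le> \<bar>K\<bar> * (norm q)\<^sup>2" if "q \<in> DS" for q
    proof -
      have "\<bar>inner q (J (B q))\<bar> \<le> norm q * norm (B q)"
        using Cauchy_Schwarz_ineq2[of q "J (B q)"] by (simp add: complex_structureD(2)[OF J])
      also have "\<dots> \<le> norm q * (\<bar>K\<bar> * norm q)"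
        using K[OF that] mult_right_mono[OF abs_ge_self[of K], of "norm q"] by (intro mult_left_mono) auto
      finally show ?thesis by (simp add: power2_eq_square algebra_simps)
    qed
    then show ?thesis by (intro exI[of _ "\<bar>K\<bar>"]) auto
  qed
  then obtain K where K: "K \<ge> 0" "\<And>q. q \<in> DS \<Longrightarrow> \<bar>inner q (J (B q))\<bar> \<le> K * (norm q)\<^sup>2" by blast
  have "\<bar>inner z (damping z)\<bar> \<le> (K + \<gamma>) * (norm z)\<^sup>2" if "z \<in> DS \<times> DS" for z
  proof -
    obtain p q where z: "z = (p, q)" "p \<in> DS" "q \<in> DS" using \<open>z \<in> DS \<times> DS\<close> by auto
    have n: "norm p \<le> norm z" "norm q \<le> norm z" unfolding z(1) by (rule norm_fst_le norm_snd_le)+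
    have "\<bar>inner z (damping z)\<bar> \<le> \<bar>inner q (J (B q))\<bar> + \<bar>inner q (C (S_inv p))\<bar>"
      by (simp add: z(1) damping_def inner_diff_right)
    also have "\<bar>inner q (J (B q))\<bar> \<le> K * (norm z)\<^sup>2"
      using K(2)[OF z(3)] mult_left_mono[OF power_mono[OF n(2), of 2] K(1)] by simp
    also have "\<bar>inner q (C (S_inv p))\<bar> \<le> norm q * norm (C (S_inv p))" by (rule Cauchy_Schwarz_ineq2)
    also have "\<dots> \<le> norm z * (\<gamma> * norm z)"
      using n norm_C_S_inv_le[of p] mult_left_mono[OF n(1) \<gamma>_nonneg] by (intro mult_mono) auto
    finally show ?thesis by (simp add: power2_eq_square algebra_simps)
  qed
  then show ?thesis by blast
qed

definition generator :: "'a \<times> 'a \<Rightarrow> 'a \<times> 'a" where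
  "generator z = free z + damping z"

lemma linear_op_generator: "linear_op (DS \<times> DS) generator"
  using linear_op_free linear_op_damping unfolding linear_op_def generator_def
  by (auto simp: algebra_simps)

lemma generator_quasi_skew:
  obtains \<omega> where "\<And>z. z \<in> DS \<times> DS \<Longrightarrow> \<bar>inner z (generator z)\<bar> \<le> \<omega> * (norm z)\<^sup>2"
proof -
  obtain \<omega> where "\<And>z. z \<in> DS \<times> DS \<Longrightarrow> \<bar>inner z (damping z)\<bar> \<le> \<omega> * (norm z)\<^sup>2"
    using damping_quasi_skew by blast
  then show ?thesis using that[of \<omega>] free_skew by (simp add: generator_def inner_add_right)
qed

text \<open>The threshold is where \<open>a + (\<bar>b\<bar> + \<gamma>) / \<bar>l\<bar>\<close>
  would reach 1; adding 1 makes the inequality strict and \<open>l\<close> nonzero.\<close>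

lemma shift_generator_surj:
  assumes l: "\<bar>l\<bar> \<ge> (\<bar>b\<bar> + \<gamma>) / (1 - a) + 1"
  shows "\<exists>z\<in>DS \<times> DS. l *\<^sub>R z - generator z = f"
  unfolding generator_def
proof (rule perturbed_range[OF linear_op_free linear_op_damping _ _ _ _ norm_damping_le a(1)])
  have nn: "(\<bar>b\<bar> + \<gamma>) / (1 - a) \<ge> 0" using a \<gamma>_nonneg by simp
  then show l0: "l \<noteq> 0" using l by auto
  show "\<exists>z\<in>DS \<times> DS. l *\<^sub>R z - free z = f" for f by (rule shift_free_surj[OF l0])
  show "\<bar>l\<bar> * norm z \<le> norm (l *\<^sub>R z - free z)" if "z \<in> DS \<times> DS" for z
    by (rule power2_le_imp_le) (simp_all add: norm_square_shift_free[OF that] power_mult_distrib)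
  show "norm (free z) \<le> norm (l *\<^sub>R z - free z)" if "z \<in> DS \<times> DS" for z
    by (rule power2_le_imp_le) (simp_all add: norm_square_shift_free[OF that])
  show "0 \<le> \<bar>b\<bar> + \<gamma>" using \<gamma>_nonneg by simp
  have "(\<bar>b\<bar> + \<gamma>) / (1 - a) < \<bar>l\<bar>" using l by simp
  then have "\<bar>b\<bar> + \<gamma> < \<bar>l\<bar> * (1 - a)" using a by (simp add: divide_less_eq)
  then have "(\<bar>b\<bar> + \<gamma>) / \<bar>l\<bar> < 1 - a" using l0 by (simp add: divide_less_eq mult.commute)
  then show "a + (\<bar>b\<bar> + \<gamma>) / \<bar>l\<bar> < 1" by simp
qed

lemma phase_solution_exists:
  assumes "z0 \<in> DS \<times> DS"
  shows "\<exists>z. z t0 = z0 \<and> (\<forall>t. z t \<in> DS \<times> DS \<and> (z has_vector_derivative generator (z t)) (at t))"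
proof -
  obtain \<omega> where \<omega>: "\<And>z. z \<in> DS \<times> DS \<Longrightarrow> \<bar>inner z (generator z)\<bar> \<le> \<omega> * (norm z)\<^sup>2"
    by (rule generator_quasi_skew) blast
  have "closure (DS \<times> DS) = UNIV" by (simp add: closure_Times S_real(2))
  from group_solution[OF linear_op_generator this \<omega> shift_generator_surj assms] show ?thesis .
qed

section \<open>Translation between the wave equation and the first order system\<close>

lemma generator_Pair: "generator (p, q) = (S q, - S p - J (B q) - C (S_inv p))"
  by (simp add: generator_def free_def damping_def)

definition classical_solution :: "(real \<Rightarrow> 'a) \<Rightarrow> (real \<Rightarrow> 'a) \<Rightarrow> bool" where
  "classical_solution u u' \<longleftrightarrow> (\<forall>t. W1_has_derivative DS S u (u' t) t) \<and>
     (\<exists>u''. \<forall>t. (u' has_vector_derivative u'' t) (at t) \<and> u t \<in> DA \<and>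
        u'' t + cscale J \<i> (B (u' t)) + (A (u t) + C (u t)) = 0)"

text \<open>The norm of \<open>W1\<close> is the norm after applying \<open>S\<close>, and
  \<open>S\<close> commutes with difference quotients.\<close>

lemma W1_has_derivative_iff:
  assumes "\<And>t. u t \<in> DS" "v \<in> DS"
  shows "W1_has_derivative DS S u v t \<longleftrightarrow> ((\<lambda>t. S (u t)) has_vector_derivative S v) (at t)"
proof -
  have "S ((u (t + h) - u t) /\<^sub>R h - v) = (S (u (t + h)) - S (u t)) /\<^sub>R h - S v" for h
    using assms by (simp add: S_lin subspace_diff[OF S_lin(1)] subspace_scale[OF S_lin(1)])
  then have "W1_has_derivative DS S u v t \<longleftrightarrow>
      (\<lambda>h. norm ((S (u (t + h)) - S (u t)) /\<^sub>R h - S v)) \<midarrow>0\<rightarrow> 0"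
    using assms by (simp add: W1_has_derivative_def)
  also have "\<dots> \<longleftrightarrow> (\<lambda>h. norm (S (u (t + h)) - S (u t) - h *\<^sub>R S v) / norm h) \<midarrow>0\<rightarrow> 0"
  proof (rule LIM_cong[OF refl])
    fix h :: real assume "h \<noteq> 0"
    then have "(S (u (t + h)) - S (u t)) /\<^sub>R h - S v = (S (u (t + h)) - S (u t) - h *\<^sub>R S v) /\<^sub>R h"
      by (simp add: scaleR_diff_right)
    then show "norm ((S (u (t + h)) - S (u t)) /\<^sub>R h - S v) =
        norm (S (u (t + h)) - S (u t) - h *\<^sub>R S v) / norm h"
      by (simp add: divide_inverse mult.commute)
  qed simp
  also have "\<dots> \<longleftrightarrow> ((\<lambda>t. S (u t)) has_vector_derivative S v) (at t)"
    by (simp add: has_vector_derivative_def has_derivative_at bounded_linear_scaleR_left)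
  finally show ?thesis .
qed

text \<open>The first component of the system is differentiability into \<open>W1\<close>; the
  second is the wave equation with \<open>A u\<close> written as \<open>S (S u)\<close>.\<close>

lemma classical_solution_iff:
  "classical_solution u u' \<longleftrightarrow> (\<forall>t. u t \<in> DA \<and> u' t \<in> DS) \<and>
     (\<forall>t. ((\<lambda>t. (S (u t), u' t)) has_vector_derivative generator (S (u t), u' t)) (at t))"
  (is "?l \<longleftrightarrow> ?D \<and> ?r")
proof
  assume l: ?l
  then have D: ?D unfolding classical_solution_def W1_has_derivative_def by blast
  then have D': "u t \<in> DS" "S (u t) \<in> DS" "S (S (u t)) = A (u t)" for t using in_DA_iff S_S by auto
  obtain u'' where u'': "\<And>t. (u' has_vector_derivative u'' t) (at t)"
    "\<And>t. u'' t + cscale J \<i> (B (u' t)) + (A (u t) + C (u t)) = 0"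
    using l unfolding classical_solution_def by blast
  have 1: "((\<lambda>t. S (u t)) has_vector_derivative S (u' t)) (at t)" for t
    using l W1_has_derivative_iff[of u "u' t" t] D D' unfolding classical_solution_def by blast
  have 2: "u'' t = - S (S (u t)) - J (B (u' t)) - C (S_inv (S (u t)))" for t
  proof -
    have "u'' t + (J (B (u' t)) + (A (u t) + C (u t))) = 0"
      using u''(2)[of t] by (simp add: cscale_def add.assoc)
    then show ?thesis using D' by (simp add: S_inv_S eq_neg_iff_add_eq_0[symmetric])
  qed
  have ?r
    using has_vector_derivative_Pair[OF 1 u''(1)] unfolding generator_Pair 2 by blast
  then show "?D \<and> ?r" using D by blast
next
  assume r: "?D \<and> ?r"
  then have D': "u t \<in> DS" "u' t \<in> DS" "S (u t) \<in> DS" "S (S (u t)) = A (u t)" for t using in_DA_iff S_S by auto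
  have *: "((\<lambda>t. (S (u t), u' t)) has_vector_derivative generator (S (u t), u' t)) (at t)" for t
    using r by blast
  have 1: "((\<lambda>t. S (u t)) has_vector_derivative S (u' t)) (at t)" for t
    using bounded_linear.has_vector_derivative[OF bounded_linear_fst *[of t]] by (simp add: generator_Pair)
  have 2: "(u' has_vector_derivative - S (S (u t)) - J (B (u' t)) - C (S_inv (S (u t)))) (at t)" for t
    using bounded_linear.has_vector_derivative[OF bounded_linear_snd *[of t]] by (simp add: generator_Pair)
  show ?l
    unfolding classical_solution_def
  proof (intro conjI allI exI[of _ "\<lambda>t. - S (S (u t)) - J (B (u' t)) - C (S_inv (S (u t)))"])
    fix t
    show "W1_has_derivative DS S u (u' t) t" using 1 D' by (simp add: W1_has_derivative_iff)
    show "u t \<in> DA" using r by blast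
    show "- S (S (u t)) - J (B (u' t)) - C (S_inv (S (u t))) + cscale J \<i> (B (u' t)) + (A (u t) + C (u t)) = 0"
      using D' by (simp add: cscale_def S_inv_S)
  qed (rule 2)
qed

theorem classical_solution_exists_unique:
  assumes \<xi>: "\<xi> \<in> DA" and \<eta>: "\<eta> \<in> DS"
  shows "\<exists>!u. \<exists>u'. classical_solution u u' \<and> u t0 = \<xi> \<and> u' t0 = \<eta>"
proof (rule ex_ex1I)
  have z0: "(S \<xi>, \<eta>) \<in> DS \<times> DS" using \<xi> \<eta> in_DA_iff by auto
  from phase_solution_exists[OF this, of t0] obtain z where z: "z t0 = (S \<xi>, \<eta>)"
    "\<And>t. z t \<in> DS \<times> DS" "\<And>t. (z has_vector_derivative generator (z t)) (at t)" by blast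
  \<comment> \<open>The position is recovered from \<open>p = S u\<close>; it lies in
    \<open>DA\<close> because \<open>p\<close> stays in \<open>DS\<close>.\<close>
  let ?u = "\<lambda>t. S_inv (fst (z t))" and ?v = "\<lambda>t. snd (z t)"
  have eq: "(S (?u t), ?v t) = z t" for t by (simp add: S_inv)
  have "?u t \<in> DA \<and> ?v t \<in> DS" for t
    using z(2)[of t] by (auto simp: in_DA_iff S_inv mem_Times_iff)
  then have "classical_solution ?u ?v" unfolding classical_solution_iff eq using z(3) by blast
  moreover have "?u t0 = \<xi>" "?v t0 = \<eta>" using z(1) \<xi> in_DA_iff by (auto simp: S_inv_S)
  ultimately show "\<exists>u u'. classical_solution u u' \<and> u t0 = \<xi> \<and> u' t0 = \<eta>" by blast
next
  fix u v
  assume "\<exists>u'. classical_solution u u' \<and> u t0 = \<xi> \<and> u' t0 = \<eta>"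
    and "\<exists>u'. classical_solution v u' \<and> v t0 = \<xi> \<and> u' t0 = \<eta>"
  then obtain u' v' where u: "classical_solution u u'" "u t0 = \<xi>" "u' t0 = \<eta>"
    and v: "classical_solution v v'" "v t0 = \<xi>" "v' t0 = \<eta>" by blast
  obtain \<omega> where \<omega>: "\<And>z. z \<in> DS \<times> DS \<Longrightarrow> \<bar>inner z (generator z)\<bar> \<le> \<omega> * (norm z)\<^sup>2"
    by (rule generator_quasi_skew) blast
  have D: "(S (w t), w' t) \<in> DS \<times> DS" "w t \<in> DS" if "classical_solution w w'" for w w' t
    using that by (auto simp: classical_solution_iff in_DA_iff)
  have der: "((\<lambda>t. (S (w t), w' t)) has_vector_derivative generator (S (w t), w' t)) (at t)"
    if "classical_solution w w'" for w w' t
    using that by (auto simp: classical_solution_iff)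
  \<comment> \<open>Both phase curves start at the same point, so they coincide; injectivity of
    \<open>S\<close> then gives equality of \<open>u\<close> and \<open>v\<close>.\<close>
  have "(S (u t), u' t) = (S (v t), v' t)" for t
    by (rule group_solution_unique[OF linear_op_generator \<omega> D(1)[OF u(1)] der[OF u(1)]
          D(1)[OF v(1)] der[OF v(1)], of t0]) (use u v in auto)
  then have "u t = v t" for t using S_inject D(2)[OF u(1)] D(2)[OF v(1)] by blast
  then show "u = v" by blast
qed

end

theorem theorem11:
  fixes J :: "'a::{real_inner, complete_space} \<Rightarrow> 'a"
    and DA DS :: "'a set"
    and A S B C :: "'a \<Rightarrow> 'a"
    and \<epsilon> a b c d t0 :: real
    and \<xi> \<eta> :: 'a
  assumes J: "complex_structure J"
    and nontriv: "\<exists>x::'a. x \<noteq> 0"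
    and A_sa: "self_adjoint_op J DA A"
    and eps: "\<epsilon> > 0"
    and A_pos: "\<forall>x\<in>DA. Re (cinner J x (A x)) \<ge> \<epsilon> * Re (cinner J x x)"
    and S: "is_sqrt_op J DA A DS S"
    and B_lin: "clinear_on J DS B"
    and a: "0 \<le> a" "a < 1"
    and B_bound: "\<forall>x\<in>DS. (norm (B x))\<^sup>2 \<le> a\<^sup>2 * (norm (S x))\<^sup>2 + b\<^sup>2 * (norm x)\<^sup>2"
    and B_sym_or_bdd: "(\<forall>x\<in>DS. \<forall>y\<in>DS. cinner J (B x) y = cinner J x (B y))
                       \<or> (\<exists>K. \<forall>x\<in>DS. norm (B x) \<le> K * norm x)"
    and C_lin: "clinear_on J DS C"
    and C_bound: "\<forall>x\<in>DS. (norm (C x))\<^sup>2 \<le> c\<^sup>2 * (norm (S x))\<^sup>2 + d\<^sup>2 * (norm x)\<^sup>2"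
    and \<xi>: "\<xi> \<in> DA"
    and \<eta>: "\<eta> \<in> DS"
  shows "\<exists>!u :: real \<Rightarrow> 'a.
           (\<exists>u' :: real \<Rightarrow> 'a.
              (\<forall>t. W1_has_derivative DS S u (u' t) t) \<and>
              u t0 = \<xi> \<and> u' t0 = \<eta> \<and>
              (\<exists>u'' :: real \<Rightarrow> 'a. \<forall>t. (u' has_vector_derivative u'' t) (at t) \<and>
                  u t \<in> DA \<and>
                  u'' t + cscale J \<i> (B (u' t)) + (A (u t) + C (u t)) = 0))"
proof -
  interpret damped_wave J DA DS A S B C \<epsilon> a b c d
    by unfold_locales (fact assms)+
  show ?thesis
    using classical_solution_exists_unique[OF \<xi> \<eta>, of t0] unfolding classical_solution_def
    by (simp only: conj_ac)
qed

end
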